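(* Let $(X,\mathcal B,\mu)$ be a separable probability space and let $G$ be a free finitely generated abelian group acting on $X$ by $\mu$-preserving transformations. Let $T_j,\hat T_j\in G$, $j=1,\dots,\ell$, where $T_1,\dots,T_\ell$ are distinct and different from the identity $\mathrm{id}$ of $G$, while $\hat T_1,\dots,\hat T_\ell$ are any transformations from $G$. Set $T_0=\hat T_0=\mathrm{id}$. Then for any $A\in\mathcal B$ with $\mu(A)>0$ there exists an infinite subset $\mathcal N_A\subset\mathbb N$ of positive integers with uniformly bounded gaps such that $$\liminf_{N\to\infty,\ N\in\mathcal N_A}\frac 1N\sum_{n=1}^N\mu\Big(\bigcap_{j=0}^\ell(T_j^n\hat T_j^N)^{-1}A\Big)>0.$$
   Context: An infinite set of positive integers has uniformly bounded gaps if the differences between its consecutive elements are bounded by a constant. *)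

theory Defs
  imports
    "HOL-Probability.Probability"
    "HOL-Algebra.Group_Action"
    "HOL-Algebra.Free_Abelian_Groups"
begin

text \<open>Separability of the measure algebra: a countable family of measurable sets is dense for the
  pseudometric $d(A,B) = \mu(A \mathbin{\triangle} B)$. Any probability space whose $\sigma$-algebra
  is countably generated, possibly up to null sets, satisfies this.\<close>

definition separable_measure :: "'a measure \<Rightarrow> bool" where
  "separable_measure M \<longleftrightarrow>
     (\<exists>C. countable C \<and> C \<subseteq> sets M \<and>
        (\<forall>A\<in>sets M. \<forall>e>0. \<exists>B\<in>C. measure M ((A - B) \<union> (B - A)) < e))"

text \<open>The index sets of the standard free abelian groups are taken in \<^typ>\<open>nat\<close>; this covers every
  finite rank.\<close>

definition free_fg_abelian_group :: "('g, 'm) monoid_scheme \<Rightarrow> bool" where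
  "free_fg_abelian_group G \<longleftrightarrow>
     comm_group G \<and> (\<exists>S :: nat set. finite S \<and> G \<cong> free_Abelian_group S)"

definition measure_preserving_map :: "'a measure \<Rightarrow> ('a \<Rightarrow> 'a) \<Rightarrow> bool" where
  "measure_preserving_map M f \<longleftrightarrow>
     f \<in> measurable M M \<and>
     (\<forall>A\<in>sets M. emeasure M (f -` A \<inter> space M) = emeasure M A)"

text \<open>\<^term>\<open>a\<close> and \<^term>\<open>b\<close> range over the pairs of consecutive elements of \<^term>\<open>S\<close>.\<close>

definition uniformly_bounded_gaps :: "nat set \<Rightarrow> bool" where
  "uniformly_bounded_gaps S \<longleftrightarrow>
     (\<exists>K. \<forall>a\<in>S. \<forall>b\<in>S. a < b \<and> S \<inter> {a<..<b} = {} \<longrightarrow> b - a \<le> K)"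

end

theory Submission
  imports Defs "HOL-Real_Asymp.Real_Asymp"
begin

text \<open>Write \<open>q(n,N)\<close> for the measure of the intersection of the preimages of \<open>A\<close> under
\<open>T\<^sub>j\<^sup>n T'\<^sub>j\<^sup>N\<close>. The theorem is a consequence of recurrence along finite sums
(\<open>IP_multiple_recurrence\<close>): there are \<open>m\<close> and \<open>c > 0\<close> such that among any \<open>m\<close> pairs
\<open>(n\<^sub>i,N\<^sub>i)\<close> some nonempty subfamily has a sum \<open>(n,N)\<close> with \<open>q(n,N) \<ge> c\<close>. Let \<open>N\<close> be rich if
\<open>q(n,N) \<ge> c\<close> holds for at least \<open>N / 2\<^bsup>m+2\<^esup>\<close> of the \<open>n \<le> N\<close>. If there were arbitrarily long intervals
without rich numbers, one could choose \<open>N\<^sub>0, N\<^sub>1, ...\<close> from longer and longer such intervals so that no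
subsum is rich, and then choose \<open>n\<^sub>0, n\<^sub>1, ...\<close> greedily so that no sum of pairs has \<open>q \<ge> c\<close>, a
contradiction (\<open>IP_recurrent_pairs_syndetic\<close>). So the rich numbers have bounded gaps, and along them
the averages are at least \<open>c / 2\<^bsup>m+2\<^esup>\<close>.

Recurrence along finite sums comes from the density Hales-Jewett theorem for the alphabet of the
\<open>l + 1\<close> indices \<open>j\<close>. A word \<open>w\<close> of length \<open>m\<close> is sent to the group element \<open>\<Prod>\<^sub>i g i (w i)\<close>; for a
point \<open>x\<close> consider the words whose element moves \<open>x\<close> into \<open>A\<close>. On average over \<open>x\<close> they have density
\<open>\<mu>(A)\<close>, so that for many \<open>x\<close> they contain a combinatorial line, and for a set of \<open>x\<close> of measure bounded
below the same line. The points of a line differ only at its wildcard positions \<open>\<alpha>\<close>, and the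
factor coming from the other positions is removed by invariance of the measure.

The density Hales-Jewett theorem is proved by induction on the number \<open>k\<close> of letters, along the lines
of the combinatorial proofs of Polymath and of Dodos, Kanellopoulos and Tyros. Suppose it holds for
\<open>k\<close> letters and fails for \<open>k + 1\<close>. Then the line-free sets over \<open>k + 1\<close> letters have a positive critical
density \<open>\<alpha>\<close> (\<open>critical_density\<close>): in high dimension their density is at most slightly above \<open>\<alpha>\<close>, also
inside every high-dimensional subspace, and values near \<open>\<alpha>\<close> are attained. Two facts contradict each
other.

\<^item> There are a constant \<open>\<theta> > 0\<close> and, in arbitrarily high dimension, line-free sets \<open>A\<close> of density
  nearly \<open>\<alpha>\<close> that avoid a set \<open>D\<^sub>0 \<inter> ... \<inter> D\<^bsub>k-1\<^esub>\<close> of density at least \<open>\<theta>\<close>, where \<open>D\<^sub>i\<close> does not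
  distinguish the letter \<open>k\<close> from the letter \<open>i\<close> (\<open>dense_obstruction\<close>). Hence \<open>A\<close> has relative density
  greater than \<open>\<alpha>\<close> by a fixed amount in the complement.

\<^item> Sets that do not distinguish \<open>k\<close> from \<open>i\<close> live essentially over \<open>k\<close> letters, and by the
  induction hypothesis they are, up to a small error, disjoint unions of high-dimensional subspaces. So
  are intersections of such sets, and the complement above is a disjoint union of \<open>k\<close> of those
  (\<open>insensitive_inter_avg_le\<close>). On each of these subspaces \<open>A\<close> has density at most slightly above \<open>\<alpha>\<close>.\<close>

section \<open>Words and averages\<close>

text \<open>Words with letters \<open>0, ..., k - 1\<close> over a finite index set. The value \<open>0\<close> outside the index set makes
words over different index sets comparable and is a letter of every nonempty alphabet.\<close>
definition words :: "nat \<Rightarrow> nat set \<Rightarrow> (nat \<Rightarrow> nat) set" where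
  "words k I = {x. (\<forall>i\<in>I. x i < k) \<and> (\<forall>i. i \<notin> I \<longrightarrow> x i = 0)}"

definition glue :: "nat set \<Rightarrow> (nat \<Rightarrow> nat) \<Rightarrow> (nat \<Rightarrow> nat) \<Rightarrow> nat \<Rightarrow> nat" where
  "glue I x y = (\<lambda>i. if i \<in> I then x i else y i)"

definition avg :: "nat \<Rightarrow> nat set \<Rightarrow> ((nat \<Rightarrow> nat) \<Rightarrow> real) \<Rightarrow> real" where
  "avg k I f = (\<Sum>x\<in>words k I. f x) / real k ^ card I"

abbreviation dens :: "nat \<Rightarrow> nat set \<Rightarrow> (nat \<Rightarrow> nat) set \<Rightarrow> real" where
  "dens k I A \<equiv> avg k I (\<lambda>x. of_bool (x \<in> A))"

lemma words_eq_PiE_dflt: "words k I = PiE_dflt I 0 (\<lambda>_. {..<k})"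
  by (auto simp: words_def PiE_dflt_def)

lemma finite_words [simp]: "finite I \<Longrightarrow> finite (words k I)"
  unfolding words_eq_PiE_dflt by (intro finite_PiE_dflt) auto

lemma card_words: "finite I \<Longrightarrow> card (words k I) = k ^ card I"
  unfolding words_eq_PiE_dflt by (subst card_PiE_dflt) auto

lemma words_less: "x \<in> words k I \<Longrightarrow> 0 < k \<Longrightarrow> x i < k"
  by (cases "i \<in> I") (auto simp: words_def)

lemma words_mono: "k \<le> k' \<Longrightarrow> words k I \<subseteq> words k' I"
  by (auto simp: words_def)

lemma glue_words: "x \<in> words k I \<Longrightarrow> y \<in> words k J \<Longrightarrow> glue I x y \<in> words k (I \<union> J)"
  by (auto simp: words_def glue_def)

lemma avg_mono: "(\<And>x. x \<in> words k I \<Longrightarrow> f x \<le> g x) \<Longrightarrow> avg k I f \<le> avg k I g"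
  unfolding avg_def by (intro divide_right_mono sum_mono) auto

lemma avg_cong: "(\<And>x. x \<in> words k I \<Longrightarrow> f x = g x) \<Longrightarrow> avg k I f = avg k I g"
  unfolding avg_def by simp

lemma avg_nonneg: "(\<And>x. x \<in> words k I \<Longrightarrow> 0 \<le> f x) \<Longrightarrow> 0 \<le> avg k I f"
  unfolding avg_def by (intro divide_nonneg_nonneg sum_nonneg) auto

lemma avg_const [simp]: "finite I \<Longrightarrow> 0 < k \<Longrightarrow> avg k I (\<lambda>_. c) = c"
  by (simp add: avg_def card_words)

lemma avg_add: "avg k I (\<lambda>x. f x + g x) = avg k I f + avg k I g"
  by (simp add: avg_def sum.distrib add_divide_distrib)

lemma avg_diff: "avg k I (\<lambda>x. f x - g x) = avg k I f - avg k I g"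
  by (simp add: avg_def sum_subtractf diff_divide_distrib)

lemma avg_cmult: "avg k I (\<lambda>x. c * f x) = c * avg k I f"
  by (simp add: avg_def flip: sum_distrib_left)

lemma avg_sum: "avg k I (\<lambda>x. \<Sum>s\<in>S. f s x) = (\<Sum>s\<in>S. avg k I (f s))"
  unfolding avg_def by (subst sum.swap) (simp add: sum_divide_distrib)

lemma avg_swap: "avg k I (\<lambda>x. avg l J (f x)) = avg l J (\<lambda>y. avg k I (\<lambda>x. f x y))"
  unfolding avg_def
  by (simp add: sum_divide_distrib, subst sum.swap) (simp add: mult.commute)

lemma avg_le: "finite I \<Longrightarrow> 0 < k \<Longrightarrow> (\<And>x. x \<in> words k I \<Longrightarrow> f x \<le> c) \<Longrightarrow> avg k I f \<le> c"
  using avg_mono[of k I f "\<lambda>_. c"] by simp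

lemma avg_ge: "finite I \<Longrightarrow> 0 < k \<Longrightarrow> (\<And>x. x \<in> words k I \<Longrightarrow> c \<le> f x) \<Longrightarrow> c \<le> avg k I f"
  using avg_mono[of k I "\<lambda>_. c" f] by simp

lemma avg_ge_imp_ex:
  assumes "finite I" "0 < k" "c \<le> avg k I f"
  shows "\<exists>x\<in>words k I. c \<le> f x"
proof (rule ccontr)
  assume "\<not> ?thesis"
  then have less: "\<And>x. x \<in> words k I \<Longrightarrow> f x < c" by force
  have "(\<lambda>_. 0) \<in> words k I" using assms(2) by (simp add: words_def)
  then have ne: "words k I \<noteq> {}" by blast
  have "(\<Sum>x\<in>words k I. f x) < (\<Sum>x\<in>words k I. c)"
    by (rule sum_strict_mono[OF finite_words[OF assms(1)] ne less])
  also have "\<dots> = c * real k ^ card I" using assms(1) by (simp add: card_words)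
  finally have "avg k I f < c" using assms(2) by (simp add: avg_def field_simps)
  with assms(3) show False by simp
qed

lemma bij_betw_glue:
  assumes "I \<inter> J = {}"
  shows "bij_betw (\<lambda>(x, y). glue I x y) (words k I \<times> words k J) (words k (I \<union> J))"
proof (rule bij_betw_byWitness[where f' = "\<lambda>z. (glue I z (\<lambda>_. 0), glue J z (\<lambda>_. 0))"])
  show "\<forall>a\<in>words k I \<times> words k J.
      (\<lambda>z. (glue I z (\<lambda>_. 0), glue J z (\<lambda>_. 0))) ((\<lambda>(x, y). glue I x y) a) = a"
    using assms by (auto simp: glue_def words_def fun_eq_iff)
  show "\<forall>z\<in>words k (I \<union> J). (\<lambda>(x, y). glue I x y) (glue I z (\<lambda>_. 0), glue J z (\<lambda>_. 0)) = z"
    by (auto simp: glue_def words_def fun_eq_iff)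
  show "(\<lambda>(x, y). glue I x y) ` (words k I \<times> words k J) \<subseteq> words k (I \<union> J)"
    by (auto intro: glue_words)
  show "(\<lambda>z. (glue I z (\<lambda>_. 0), glue J z (\<lambda>_. 0))) ` words k (I \<union> J) \<subseteq> words k I \<times> words k J"
    by (auto simp: glue_def words_def)
qed

lemma avg_glue:
  assumes "finite I" "finite J" "I \<inter> J = {}"
  shows "avg k (I \<union> J) f = avg k I (\<lambda>x. avg k J (\<lambda>y. f (glue I x y)))"
proof -
  have "(\<Sum>z\<in>words k (I \<union> J). f z) = (\<Sum>(x, y)\<in>words k I \<times> words k J. f (glue I x y))"
    using sum.reindex_bij_betw[OF bij_betw_glue[OF assms(3), of k], of f]
    by (simp add: case_prod_unfold)
  also have "\<dots> = (\<Sum>x\<in>words k I. \<Sum>y\<in>words k J. f (glue I x y))"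
    by (simp add: sum.cartesian_product)
  finally show ?thesis
    using assms by (simp add: avg_def card_Un_disjoint power_add sum_divide_distrib mult.commute)
qed

lemma avg_many_large:
  assumes "finite I" "0 < k" "a \<le> avg k I f" "\<And>x. x \<in> words k I \<Longrightarrow> f x \<le> 1" "0 \<le> a"
  shows "a / 2 \<le> avg k I (\<lambda>x. of_bool (a / 2 \<le> f x))"
proof -
  have "a \<le> avg k I (\<lambda>x. a / 2 + of_bool (a / 2 \<le> f x))"
    using assms(3)
  proof (rule order_trans, intro avg_mono)
    fix x assume "x \<in> words k I"
    then show "f x \<le> a / 2 + of_bool (a / 2 \<le> f x)" using assms(4)[of x] assms(5) by auto
  qed
  also have "\<dots> = a / 2 + avg k I (\<lambda>x. of_bool (a / 2 \<le> f x))"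
    using assms(1,2) by (simp add: avg_add)
  finally show ?thesis by simp
qed

text \<open>If no value exceeds the mean by much, then no value is much below the mean either; the price is a factor
of twice the number of words. This turns the maximality of a line-free set into a lower bound for
the density of each of its slices.\<close>

lemma avg_all_large:
  assumes "finite I" "0 < k" "a - e \<le> avg k I f" "\<And>x. x \<in> words k I \<Longrightarrow> f x \<le> a + e"
    and "x \<in> words k I" and "0 \<le> e"
  shows "a - 2 * real k ^ card I * e \<le> f x"
proof -
  have "real k ^ card I * (a - e) \<le> (\<Sum>y\<in>words k I. f y)"
    using assms(2,3) by (simp add: avg_def field_simps)
  also have "\<dots> = f x + (\<Sum>y\<in>words k I - {x}. f y)"
    by (rule sum.remove[OF finite_words[OF assms(1)] assms(5)])
  also have "(\<Sum>y\<in>words k I - {x}. f y) \<le> (\<Sum>y\<in>words k I - {x}. a + e)"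
    using assms(4) by (intro sum_mono) blast
  also have "\<dots> = (real k ^ card I - 1) * (a + e)"
    using assms(1,2,5) by (simp add: card_words of_nat_diff)
  finally have "real k ^ card I * (a - e) \<le> f x + (real k ^ card I - 1) * (a + e)" by simp
  then show ?thesis using assms(6) by (simp add: algebra_simps)
qed

section \<open>Combinatorial subspaces and the density Hales-Jewett property\<close>

text \<open>A \<open>d\<close>-dimensional combinatorial subspace of the words over \<open>I\<close> is given by a word \<open>\<sigma>\<close> in which each
position holds either a letter (\<open>Inl\<close>) or one of the variables \<open>0, ..., d - 1\<close> (\<open>Inr\<close>), every
variable occurring. Its points are obtained by plugging in words over \<open>{..<d}\<close>; a combinatorial line
is the case \<open>d = 1\<close>.\<close>
definition plug :: "(nat \<Rightarrow> nat + nat) \<Rightarrow> (nat \<Rightarrow> nat) \<Rightarrow> nat \<Rightarrow> nat" where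
  "plug \<sigma> u = (\<lambda>i. case \<sigma> i of Inl a \<Rightarrow> a | Inr j \<Rightarrow> u j)"

definition comb_subspace :: "nat \<Rightarrow> nat \<Rightarrow> nat set \<Rightarrow> (nat \<Rightarrow> nat + nat) \<Rightarrow> bool" where
  "comb_subspace k d I \<sigma> \<longleftrightarrow>
     (\<forall>i\<in>I. case \<sigma> i of Inl a \<Rightarrow> a < k | Inr j \<Rightarrow> j < d) \<and>
     (\<forall>i. i \<notin> I \<longrightarrow> \<sigma> i = Inl 0) \<and> (\<forall>j<d. \<exists>i\<in>I. \<sigma> i = Inr j)"

definition has_subspace :: "nat \<Rightarrow> nat \<Rightarrow> nat set \<Rightarrow> (nat \<Rightarrow> nat) set \<Rightarrow> bool" where
  "has_subspace k d I A \<longleftrightarrow> (\<exists>\<sigma>. comb_subspace k d I \<sigma> \<and> (\<forall>u\<in>words k {..<d}. plug \<sigma> u \<in> A))"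

lemma comb_subspaceI:
  assumes "\<And>i a. i \<in> I \<Longrightarrow> \<sigma> i = Inl a \<Longrightarrow> a < k" "\<And>i j. i \<in> I \<Longrightarrow> \<sigma> i = Inr j \<Longrightarrow> j < d"
    "\<And>i. i \<notin> I \<Longrightarrow> \<sigma> i = Inl 0" "\<And>j. j < d \<Longrightarrow> \<exists>i\<in>I. \<sigma> i = Inr j"
  shows "comb_subspace k d I \<sigma>"
  using assms by (auto simp: comb_subspace_def split: sum.splits)

lemma comb_subspaceD:
  assumes "comb_subspace k d I \<sigma>"
  shows "i \<in> I \<Longrightarrow> \<sigma> i = Inl a \<Longrightarrow> a < k" "\<sigma> i = Inr j \<Longrightarrow> j < d" "\<sigma> i = Inr j \<Longrightarrow> i \<in> I"
    "i \<notin> I \<Longrightarrow> \<sigma> i = Inl 0" "j < d \<Longrightarrow> \<exists>i\<in>I. \<sigma> i = Inr j"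
proof -
  have I: "case \<sigma> i of Inl a \<Rightarrow> a < k | Inr j \<Rightarrow> j < d" if "i \<in> I" for i
    using assms that unfolding comb_subspace_def by blast
  show out: "\<sigma> i = Inl 0" if "i \<notin> I" for i
    using assms that unfolding comb_subspace_def by blast
  show "a < k" if "i \<in> I" "\<sigma> i = Inl a" using I[OF that(1)] that(2) by simp
  show inI: "i \<in> I" if "\<sigma> i = Inr j" using out[of i] that by (cases "i \<in> I") simp_all
  show "j < d" if "\<sigma> i = Inr j" using I[OF inI[OF that]] that by simp
  show "\<exists>i\<in>I. \<sigma> i = Inr j" if "j < d" using assms that unfolding comb_subspace_def by blast
qed

lemma plug_words: "comb_subspace k d I \<sigma> \<Longrightarrow> u \<in> words k {..<d} \<Longrightarrow> plug \<sigma> u \<in> words k I"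
  by (auto simp: words_def plug_def comb_subspace_def split: sum.splits)

lemma inj_on_plug:
  assumes "comb_subspace k d I \<sigma>" shows "inj_on (plug \<sigma>) (words k {..<d})"
proof (rule inj_onI, rule ext)
  fix u v j assume u: "u \<in> words k {..<d}" and v: "v \<in> words k {..<d}" and e: "plug \<sigma> u = plug \<sigma> v"
  show "u j = v j"
  proof (cases "j < d")
    case True
    then obtain i where "\<sigma> i = Inr j" using comb_subspaceD(5)[OF assms] by blast
    then show ?thesis using fun_cong[OF e, of i] by (simp add: plug_def)
  qed (use u v in \<open>auto simp: words_def\<close>)
qed

lemma comb_subspace_comp:
  assumes \<sigma>: "comb_subspace k d I \<sigma>" and \<tau>: "comb_subspace k e {..<d} \<tau>"
  shows "comb_subspace k e I (\<lambda>i. case \<sigma> i of Inl a \<Rightarrow> Inl a | Inr j \<Rightarrow> \<tau> j)"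
proof (rule comb_subspaceI)
  fix j assume "j < e"
  then obtain j' where "j' < d" "\<tau> j' = Inr j" using comb_subspaceD(5)[OF \<tau>] by blast
  moreover from this obtain i where "i \<in> I" "\<sigma> i = Inr j'" using comb_subspaceD(5)[OF \<sigma>] by blast
  ultimately show "\<exists>i\<in>I. (case \<sigma> i of Inl a \<Rightarrow> Inl a | Inr j \<Rightarrow> \<tau> j) = Inr j"
    by (intro bexI[of _ i]) auto
next
  fix i a assume i: "i \<in> I" and a: "(case \<sigma> i of Inl a \<Rightarrow> Inl a | Inr j \<Rightarrow> \<tau> j) = Inl a"
  show "a < k"
  proof (cases "\<sigma> i")
    case (Inl b)
    then show ?thesis using a comb_subspaceD(1)[OF \<sigma> i] by auto
  next
    case (Inr j)
    then show ?thesis using a comb_subspaceD(2)[OF \<sigma> Inr] comb_subspaceD(1)[OF \<tau>, of j a] by auto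
  qed
qed (use comb_subspaceD(2,4)[OF \<sigma>] comb_subspaceD(2)[OF \<tau>] in \<open>auto split: sum.splits\<close>)

lemma plug_comp: "plug (\<lambda>i. case \<sigma> i of Inl a \<Rightarrow> Inl a | Inr j \<Rightarrow> \<tau> j) u = plug \<sigma> (plug \<tau> u)"
  by (auto simp: plug_def fun_eq_iff split: sum.splits)

lemma comb_subspace_glue_left:
  assumes "comb_subspace k d J \<tau>" "x \<in> words k I" "I \<inter> J = {}"
  shows "comb_subspace k d (I \<union> J) (\<lambda>i. if i \<in> I then Inl (x i) else \<tau> i)"
proof (rule comb_subspaceI)
  fix j assume "j < d"
  then obtain i where "i \<in> J" "\<tau> i = Inr j" using comb_subspaceD(5)[OF assms(1)] by blast
  then show "\<exists>i\<in>I \<union> J. (if i \<in> I then Inl (x i) else \<tau> i) = Inr j"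
    using assms(3) by (intro bexI[of _ i]) auto
qed (use comb_subspaceD[OF assms(1)] assms in \<open>auto simp: words_def split: if_splits\<close>)

lemma plug_glue_left:
  "plug (\<lambda>i. if i \<in> I then Inl (x i) else \<tau> i) u = glue I x (plug \<tau> u)"
  by (auto simp: plug_def glue_def fun_eq_iff)

lemma glue_commute:
  "x \<in> words k I \<Longrightarrow> y \<in> words k J \<Longrightarrow> I \<inter> J = {} \<Longrightarrow> glue I x y = glue J y x"
  by (auto simp: glue_def words_def fun_eq_iff)

lemma has_subspace_slice:
  assumes "has_subspace k d J {y. glue I x y \<in> A}" "x \<in> words k I" "I \<inter> J = {}"
  shows "has_subspace k d (I \<union> J) A"
proof -
  obtain \<tau> where "comb_subspace k d J \<tau>" "\<And>u. u \<in> words k {..<d} \<Longrightarrow> glue I x (plug \<tau> u) \<in> A"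
    using assms(1) unfolding has_subspace_def by auto
  then show ?thesis unfolding has_subspace_def
    using comb_subspace_glue_left[OF _ assms(2,3)]
    by (intro exI[of _ "\<lambda>i. if i \<in> I then Inl (x i) else \<tau> i"]) (simp add: plug_glue_left)
qed

lemma has_subspace_plug:
  assumes "has_subspace k e {..<d} {u. plug \<sigma> u \<in> A}" "comb_subspace k d I \<sigma>"
  shows "has_subspace k e I A"
proof -
  obtain \<tau> where "comb_subspace k e {..<d} \<tau>" "\<And>u. u \<in> words k {..<e} \<Longrightarrow> plug \<sigma> (plug \<tau> u) \<in> A"
    using assms(1) unfolding has_subspace_def by auto
  then show ?thesis unfolding has_subspace_def
    using comb_subspace_comp[OF assms(2)]
    by (intro exI[of _ "\<lambda>i. case \<sigma> i of Inl a \<Rightarrow> Inl a | Inr j \<Rightarrow> \<tau> j"]) (simp add: plug_comp)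
qed

text \<open>The multidimensional density Hales-Jewett property; the index set is arbitrary, so that it can be used
directly on subsets of a given index set.\<close>
definition density_HJ :: "nat \<Rightarrow> nat \<Rightarrow> bool" where
  "density_HJ k d \<longleftrightarrow> (\<forall>\<delta>>0. \<exists>n. \<forall>I A. finite I \<longrightarrow> n \<le> card I \<longrightarrow> \<delta> \<le> dens k I A \<longrightarrow> has_subspace k d I A)"

lemma density_HJD:
  assumes "density_HJ k d" "0 < \<delta>"
  obtains n where "\<And>I A. finite I \<Longrightarrow> n \<le> card I \<Longrightarrow> \<delta> \<le> dens k I A \<Longrightarrow> has_subspace k d I A"
  using assms unfolding density_HJ_def by blast

lemma split_index:
  assumes "finite (I :: nat set)" "m + n \<le> card I"
  obtains I1 I2 where "I = I1 \<union> I2" "I1 \<inter> I2 = {}" "finite I1" "finite I2" "card I1 = m" "n \<le> card I2"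
proof -
  obtain I1 where I1: "I1 \<subseteq> I" "card I1 = m"
    using obtain_subset_with_card_n[of m I] assms by auto
  have "finite I1" using I1 assms finite_subset by blast
  moreover have "n \<le> card (I - I1)" using I1 assms by (simp add: card_Diff_subset finite_subset)
  ultimately show ?thesis using I1 assms by (intro that[of I1 "I - I1"]) auto
qed

lemma avg_pigeonhole:
  assumes "finite S" "S \<noteq> {}" "a \<le> avg k I (\<lambda>x. of_bool (P x))"
    and "\<And>x. x \<in> words k I \<Longrightarrow> P x \<Longrightarrow> \<exists>s\<in>S. Q s x"
  shows "\<exists>s\<in>S. a / card S \<le> avg k I (\<lambda>x. of_bool (Q s x))"
proof (rule ccontr)
  assume neg: "\<not> ?thesis"
  have less: "avg k I (\<lambda>x. of_bool (Q s x)) < a / card S" if "s \<in> S" for s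
  proof (rule ccontr)
    assume "\<not> avg k I (\<lambda>x. of_bool (Q s x)) < a / card S"
    then have "a / card S \<le> avg k I (\<lambda>x. of_bool (Q s x))" by (rule leI)
    with neg that show False by blast
  qed
  have "(\<Sum>s\<in>S. avg k I (\<lambda>x. of_bool (Q s x))) < (\<Sum>s\<in>S. a / card S)"
    by (rule sum_strict_mono[OF assms(1,2) less])
  also have "\<dots> = a" using assms(1,2) by simp
  also have "a \<le> avg k I (\<lambda>x. \<Sum>s\<in>S. of_bool (Q s x))"
  proof (rule order_trans[OF assms(3)], rule avg_mono)
    fix x assume x: "x \<in> words k I"
    show "of_bool (P x) \<le> (\<Sum>s\<in>S. of_bool (Q s x) :: real)"
    proof (cases "P x")
      case True
      then obtain s where "s \<in> S" "Q s x" using assms(4) x by blast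
      then show ?thesis using assms(1) member_le_sum[of s S "\<lambda>s. of_bool (Q s x) :: real"] True by simp
    qed (simp add: sum_nonneg)
  qed
  finally show False by (simp add: avg_sum)
qed

section \<open>From lines to subspaces\<close>

lemma density_HJ_0: assumes "0 < k" shows "density_HJ k 0"
  unfolding density_HJ_def
proof (intro allI impI exI[of _ 0])
  fix \<delta> :: real and I A assume *: "0 < \<delta>" "finite I" "\<delta> \<le> dens k I A"
  then obtain x where x: "x \<in> words k I" "\<delta> \<le> of_bool (x \<in> A)"
    using avg_ge_imp_ex[of I k \<delta>] assms by blast
  then have "x \<in> A" using * by (cases "x \<in> A") auto
  have "comb_subspace k 0 I (\<lambda>i. Inl (x i))" using x by (intro comb_subspaceI) (auto simp: words_def)
  then show "has_subspace k 0 I A" using \<open>x \<in> A\<close> by (auto simp: has_subspace_def plug_def)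
qed

text \<open>Split the positions into a bounded part \<open>I1\<close> and a long part \<open>I2\<close>. A dense set has many dense slices over
\<open>I1\<close>, and there is only a bounded number of possible slices; so one slice \<open>C\<close> occurs for a dense set of
words over \<open>I2\<close>. The product of a \<open>d\<close>-dimensional subspace inside \<open>C\<close> and a line inside the set of
those words is the required subspace.\<close>

lemma density_HJ_Suc:
  assumes k: "0 < k" and d: "density_HJ k d" and 1: "density_HJ k 1"
  shows "density_HJ k (Suc d)"
  unfolding density_HJ_def
proof (intro allI impI)
  fix \<delta> :: real assume \<delta>: "0 < \<delta>"
  obtain m where m: "\<And>I A. finite I \<Longrightarrow> m \<le> card I \<Longrightarrow> \<delta> / 2 \<le> dens k I A \<Longrightarrow> has_subspace k d I A"
    using density_HJD[OF d] \<delta> half_gt_zero by blast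
  define \<delta>' where "\<delta>' = \<delta> / 2 / real (2 ^ (k ^ m))"
  have "\<delta>' > 0" using \<delta> by (simp add: \<delta>'_def)
  obtain n where n: "\<And>I A. finite I \<Longrightarrow> n \<le> card I \<Longrightarrow> \<delta>' \<le> dens k I A \<Longrightarrow> has_subspace k 1 I A"
    using density_HJD[OF 1 \<open>\<delta>' > 0\<close>] by blast
  show "\<exists>n. \<forall>I A. finite I \<longrightarrow> n \<le> card I \<longrightarrow> \<delta> \<le> dens k I A \<longrightarrow> has_subspace k (Suc d) I A"
  proof (intro exI[of _ "m + n"] allI impI)
    fix I A assume "finite I" "m + n \<le> card I" and dA: "\<delta> \<le> dens k I A"
    then obtain I1 I2 where I: "I = I1 \<union> I2" "I1 \<inter> I2 = {}" and fin: "finite I1" "finite I2"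
      and cI: "card I1 = m" "n \<le> card I2" using split_index by metis
    define B where "B y = {x \<in> words k I1. glue I1 x y \<in> A}" for y
    have "\<delta> \<le> avg k I2 (\<lambda>y. dens k I1 (B y))"
      using dA unfolding I(1) avg_glue[OF fin I(2)]
      by (subst (asm) avg_swap) (simp add: B_def cong: avg_cong)
    then have "\<delta> / 2 \<le> avg k I2 (\<lambda>y. of_bool (\<delta> / 2 \<le> dens k I1 (B y)))"
      using fin k \<delta> by (intro avg_many_large avg_le) auto
    then have "\<exists>C\<in>Pow (words k I1). \<delta> / 2 / card (Pow (words k I1))
        \<le> avg k I2 (\<lambda>y. of_bool (\<delta> / 2 \<le> dens k I1 C \<and> B y = C))"
    proof (rule avg_pigeonhole[rotated 2])
      show "\<exists>C\<in>Pow (words k I1). \<delta> / 2 \<le> dens k I1 C \<and> B y = C" if "\<delta> / 2 \<le> dens k I1 (B y)" for y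
        using that by (intro bexI[of _ "B y"]) (auto simp: B_def)
    qed (use fin in auto)
    then obtain C where C: "C \<in> Pow (words k I1)" "\<delta> / 2 / card (Pow (words k I1))
        \<le> avg k I2 (\<lambda>y. of_bool (\<delta> / 2 \<le> dens k I1 C \<and> B y = C))" by blast
    then have C': "\<delta>' \<le> dens k I2 {y. \<delta> / 2 \<le> dens k I1 C \<and> B y = C}"
      using fin cI by (simp add: \<delta>'_def card_Pow card_words)
    from n[OF fin(2) cI(2) C'] obtain \<tau> where \<tau>: "comb_subspace k 1 I2 \<tau>"
      and \<tau>C: "\<And>u. u \<in> words k {..<1} \<Longrightarrow> \<delta> / 2 \<le> dens k I1 C \<and> B (plug \<tau> u) = C"
      unfolding has_subspace_def by auto
    have "(\<lambda>_. 0) \<in> words k {..<1}" using k by (auto simp: words_def)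
    with \<tau>C have "\<delta> / 2 \<le> dens k I1 C" by blast
    from m[OF fin(1) _ this] cI obtain \<sigma> where \<sigma>: "comb_subspace k d I1 \<sigma>"
      and \<sigma>C: "\<And>u. u \<in> words k {..<d} \<Longrightarrow> plug \<sigma> u \<in> C"
      unfolding has_subspace_def by auto
    define \<rho> where "\<rho> i = (if i \<in> I1 then \<sigma> i else case \<tau> i of Inl a \<Rightarrow> Inl a | Inr j \<Rightarrow> Inr d)" for i
    have "comb_subspace k (Suc d) I \<rho>"
    proof (rule comb_subspaceI)
      fix j assume "j < Suc d"
      show "\<exists>i\<in>I. \<rho> i = Inr j"
      proof (cases "j = d")
        case True
        obtain i where "i \<in> I2" "\<tau> i = Inr 0" using comb_subspaceD(5)[OF \<tau>, of 0] by auto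
        then show ?thesis using I True by (intro bexI[of _ i]) (auto simp: \<rho>_def)
      next
        case False
        then obtain i where "i \<in> I1" "\<sigma> i = Inr j"
          using comb_subspaceD(5)[OF \<sigma>, of j] \<open>j < Suc d\<close> by auto
        then show ?thesis using I by (intro bexI[of _ i]) (auto simp: \<rho>_def)
      qed
    qed (use comb_subspaceD[OF \<sigma>] comb_subspaceD[OF \<tau>] I in
        \<open>auto simp: \<rho>_def less_Suc_eq split: if_splits sum.splits\<close>)
    moreover have "plug \<rho> u \<in> A" if u: "u \<in> words k {..<Suc d}" for u
    proof -
      define u1 where "u1 = (\<lambda>j. if j < d then u j else 0)"
      define u2 where "u2 = (\<lambda>j::nat. if j < 1 then u d else 0)"
      have u12: "u1 \<in> words k {..<d}" "u2 \<in> words k {..<1}"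
        using u by (auto simp: words_def u1_def u2_def)
      have "plug \<rho> u = glue I1 (plug \<sigma> u1) (plug \<tau> u2)"
        using comb_subspaceD(2)[OF \<sigma>] comb_subspaceD(2)[OF \<tau>]
        by (auto simp: plug_def glue_def \<rho>_def u1_def u2_def fun_eq_iff split: sum.splits)
      moreover have "plug \<sigma> u1 \<in> B (plug \<tau> u2)" using \<tau>C \<sigma>C u12 by auto
      ultimately show ?thesis by (auto simp: B_def)
    qed
    ultimately show "has_subspace k (Suc d) I A" by (auto simp: has_subspace_def)
  qed
qed

lemma density_HJ_of_line: "0 < k \<Longrightarrow> density_HJ k 1 \<Longrightarrow> density_HJ k d"
  by (induction d) (auto intro: density_HJ_0 density_HJ_Suc)

lemma density_HJ_one_letter: "density_HJ 1 1"
  unfolding density_HJ_def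
proof (intro allI impI exI[of _ 1])
  fix \<delta> :: real and I A assume *: "0 < \<delta>" "finite I" "1 \<le> card I" "\<delta> \<le> dens 1 I A"
  then obtain x where x: "x \<in> words 1 I" "\<delta> \<le> of_bool (x \<in> A)"
    using avg_ge_imp_ex[of I 1 \<delta>] by force
  then have "x \<in> A" using * by (cases "x \<in> A") auto
  obtain i where "i \<in> I" using * by force
  then have "comb_subspace 1 1 I (\<lambda>i. if i \<in> I then Inr 0 else Inl 0)"
    by (intro comb_subspaceI) (auto split: if_splits)
  moreover have "plug (\<lambda>i. if i \<in> I then Inr 0 else Inl 0) u = x" if "u \<in> words 1 {..<1}" for u
    using that x by (auto simp: plug_def words_def fun_eq_iff)
  ultimately show "has_subspace 1 1 I A" using \<open>x \<in> A\<close> by (auto simp: has_subspace_def)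
qed

section \<open>Insensitive sets\<close>

definition replace_letter :: "nat \<Rightarrow> nat \<Rightarrow> (nat \<Rightarrow> nat) \<Rightarrow> nat \<Rightarrow> nat" where
  "replace_letter k i x = (\<lambda>t. if x t = k then i else x t)"

text \<open>The \<open>(i, k)\<close>-insensitive sets of the literature: two words have the same image under \<open>replace_letter k i\<close>
exactly if they differ only by exchanging the letters \<open>i\<close> and \<open>k\<close> at some positions.\<close>
definition insensitive :: "nat \<Rightarrow> nat \<Rightarrow> nat set \<Rightarrow> (nat \<Rightarrow> nat) set \<Rightarrow> bool" where
  "insensitive k i I D \<longleftrightarrow> (\<forall>x\<in>words (Suc k) I. \<forall>y\<in>words (Suc k) I.
     replace_letter k i x = replace_letter k i y \<longrightarrow> x \<in> D \<longrightarrow> y \<in> D)"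

lemma insensitiveD:
  "insensitive k i I D \<Longrightarrow> x \<in> words (Suc k) I \<Longrightarrow> y \<in> words (Suc k) I \<Longrightarrow>
   replace_letter k i x = replace_letter k i y \<Longrightarrow> x \<in> D \<longleftrightarrow> y \<in> D"
  unfolding insensitive_def by metis

lemma replace_letter_words:
  "0 < k \<Longrightarrow> i < k \<Longrightarrow> x \<in> words (Suc k) I \<Longrightarrow> replace_letter k i x \<in> words k I"
  by (auto simp: words_def replace_letter_def less_Suc_eq)

lemma replace_letter_glue:
  "replace_letter k i (glue I x y) = glue I (replace_letter k i x) (replace_letter k i y)"
  by (auto simp: replace_letter_def glue_def)

lemma replace_letter_plug_cong:
  assumes "replace_letter k i u = replace_letter k i v"
  shows "replace_letter k i (plug \<sigma> u) = replace_letter k i (plug \<sigma> v)"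
proof
  fix t show "replace_letter k i (plug \<sigma> u) t = replace_letter k i (plug \<sigma> v) t"
  proof (cases "\<sigma> t")
    case (Inr j)
    then show ?thesis using fun_cong[OF assms, of j]
      by (auto simp: replace_letter_def plug_def split: if_splits)
  qed (simp add: replace_letter_def plug_def)
qed

lemma insensitive_plug:
  assumes "insensitive k i I D" "comb_subspace (Suc k) d I \<sigma>"
  shows "insensitive k i {..<d} {u. plug \<sigma> u \<in> D}"
  unfolding insensitive_def
  using insensitiveD[OF assms(1) plug_words[OF assms(2)] plug_words[OF assms(2)]
      replace_letter_plug_cong] by blast

text \<open>A word over \<open>k + 1\<close> letters is a word over \<open>k\<close> letters on the set \<open>J\<close> of positions not occupied by the
letter \<open>k\<close>.\<close>

lemma sum_words_Suc:
  assumes "finite I"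
  shows "(\<Sum>x\<in>words (Suc k) I. f x) =
    (\<Sum>J\<in>Pow I. \<Sum>u\<in>words k J. f (glue J u (\<lambda>t. if t \<in> I then k else 0)))"
proof -
  let ?w = "\<lambda>t. if t \<in> I then k else (0::nat)"
  have bij: "bij_betw (\<lambda>(J, u). glue J u ?w) (SIGMA J:Pow I. words k J) (words (Suc k) I)"
  proof (rule bij_betw_byWitness[where f' = "\<lambda>x. ({t\<in>I. x t < k}, glue {t\<in>I. x t < k} x (\<lambda>_. 0))"])
    show "\<forall>a\<in>(SIGMA J:Pow I. words k J).
      (\<lambda>x. ({t\<in>I. x t < k}, glue {t\<in>I. x t < k} x (\<lambda>_. 0))) ((\<lambda>(J, u). glue J u ?w) a) = a"
    proof
      fix a assume "a \<in> (SIGMA J:Pow I. words k J)"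
      then obtain J u where a: "a = (J, u)" and *: "J \<subseteq> I" "u \<in> words k J" by auto
      have "{t\<in>I. glue J u ?w t < k} = J" using * by (auto simp: glue_def words_def)
      moreover have "glue J (glue J u ?w) (\<lambda>_. 0) = u" using * by (auto simp: glue_def words_def)
      ultimately show "(\<lambda>x. ({t\<in>I. x t < k}, glue {t\<in>I. x t < k} x (\<lambda>_. 0)))
          ((\<lambda>(J, u). glue J u ?w) a) = a" by (simp add: a)
    qed
  qed (auto simp: glue_def words_def fun_eq_iff less_Suc_eq split: if_splits)
  have "(\<Sum>x\<in>words (Suc k) I. f x) = (\<Sum>(J, u)\<in>(SIGMA J:Pow I. words k J). f (glue J u ?w))"
    using sum.reindex_bij_betw[OF bij, of f] by (simp add: case_prod_unfold)
  also have "\<dots> = (\<Sum>J\<in>Pow I. \<Sum>u\<in>words k J. f (glue J u ?w))"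
    using assms by (subst sum.Sigma) (auto intro!: finite_words intro: finite_subset)
  finally show ?thesis .
qed

text \<open>Only few words over \<open>k + 1\<close> letters have fewer than \<open>m\<close> positions different from \<open>k\<close>: their number
is polynomial in the length times a constant.\<close>

lemma few_small_subsets:
  assumes "0 < k" "0 < e"
  shows "\<exists>n. \<forall>I :: nat set. finite I \<longrightarrow> n \<le> card I \<longrightarrow>
    (\<Sum>J | J \<subseteq> I \<and> card J < m. real k ^ card J) < e * real (Suc k) ^ card I"
proof -
  have "(\<lambda>n. real m * real k ^ m * (real n ^ m / 2 ^ n)) \<longlonglongrightarrow> real m * real k ^ m * 0"
    by (intro tendsto_mult tendsto_const) real_asymp
  then have "\<forall>\<^sub>F n in sequentially. real m * real k ^ m * (real n ^ m / 2 ^ n) < e"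
    using order_tendstoD(2)[of _ 0 _ e] assms by simp
  then obtain n0 where n0: "\<And>n. n \<ge> n0 \<Longrightarrow> real m * real k ^ m * (real n ^ m / 2 ^ n) < e"
    by (auto simp: eventually_sequentially)
  show ?thesis
  proof (intro exI[of _ "Suc n0"] allI impI)
    fix I :: "nat set" assume I: "finite I" "Suc n0 \<le> card I"
    let ?n = "card I"
    have n: "n0 \<le> ?n" "1 \<le> ?n" using I by auto
    have split: "{J. J \<subseteq> I \<and> card J < m} = (\<Union>j<m. {J. J \<subseteq> I \<and> card J = j})" by auto
    have "real (card {J. J \<subseteq> I \<and> card J < m}) \<le> (\<Sum>j<m. real (card {J. J \<subseteq> I \<and> card J = j}))"
      unfolding split of_nat_sum[symmetric] of_nat_le_iff by (rule card_UN_le) simp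
    also have "\<dots> \<le> (\<Sum>j<m. real ?n ^ m)"
    proof (intro sum_mono)
      fix j assume "j \<in> {..<m}"
      have "?n choose j \<le> ?n ^ j"
      proof (cases "j \<le> ?n")
        case True then show ?thesis by (rule binomial_le_pow)
      qed (simp add: binomial_eq_0)
      also have "\<dots> \<le> ?n ^ m" using \<open>j \<in> {..<m}\<close> n by (intro power_increasing) auto
      finally show "real (card {J. J \<subseteq> I \<and> card J = j}) \<le> real ?n ^ m"
        using I by (simp add: n_subsets flip: of_nat_power)
    qed
    finally have card: "real (card {J. J \<subseteq> I \<and> card J < m}) \<le> real m * real ?n ^ m" by simp
    have "(\<Sum>J | J \<subseteq> I \<and> card J < m. real k ^ card J) \<le> (\<Sum>J | J \<subseteq> I \<and> card J < m. real k ^ m)"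
      using assms by (intro sum_mono power_increasing) auto
    also have "\<dots> \<le> real m * real ?n ^ m * real k ^ m"
      using card by (simp add: mult_right_mono)
    also have "\<dots> < e * 2 ^ ?n"
      using n0[OF n(1)] by (simp add: field_simps)
    also have "\<dots> \<le> e * real (Suc k) ^ ?n"
      using assms by (intro mult_left_mono power_mono) auto
    finally show "(\<Sum>J | J \<subseteq> I \<and> card J < m. real k ^ card J) < e * real (Suc k) ^ ?n" .
  qed
qed

text \<open>Sort the words by the set \<open>J\<close> of positions where the letter is not \<open>k\<close>. Within one class the words
are all words over \<open>k\<close> letters on \<open>J\<close>, and most words belong to classes with large \<open>J\<close>; so in one of
these classes \<open>D\<close> is dense, and the induction hypothesis gives a subspace over \<open>k\<close> letters in \<open>D\<close>.
Insensitivity allows its variables to take the value \<open>k\<close> as well.\<close>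

lemma insensitive_has_subspace:
  assumes k: "0 < k" and M: "density_HJ k d" and e: "0 < e"
  shows "\<exists>n. \<forall>I D i. finite I \<longrightarrow> n \<le> card I \<longrightarrow> i < k \<longrightarrow> insensitive k i I D \<longrightarrow>
    e \<le> dens (Suc k) I D \<longrightarrow> has_subspace (Suc k) d I D"
proof -
  obtain m where m: "\<And>I A. finite I \<Longrightarrow> m \<le> card I \<Longrightarrow> e / 2 \<le> dens k I A \<Longrightarrow> has_subspace k d I A"
    using density_HJD[OF M] e half_gt_zero by blast
  obtain n where n: "\<And>I :: nat set. finite I \<Longrightarrow> n \<le> card I \<Longrightarrow>
    (\<Sum>J | J \<subseteq> I \<and> card J < m. real k ^ card J) < e / 2 * real (Suc k) ^ card I"
    using few_small_subsets[OF k, of "e / 2" m] e by auto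
  show ?thesis
  proof (intro exI[of _ n] allI impI)
    fix I D i assume I: "finite I" "n \<le> card I" and i: "i < k" and ins: "insensitive k i I D"
      and dens: "e \<le> dens (Suc k) I D"
    let ?w = "\<lambda>t. if t \<in> I then k else (0::nat)"
    let ?S = "{J. J \<subseteq> I \<and> card J < m}"
    have "\<exists>J. J \<subseteq> I \<and> m \<le> card J \<and> e / 2 \<le> dens k J {u. glue J u ?w \<in> D}"
    proof (rule ccontr)
      assume "\<not> ?thesis"
      then have small: "dens k J {u. glue J u ?w \<in> D} \<le> e / 2" if "J \<subseteq> I" "m \<le> card J" for J
        using that by force
      have fin: "finite J" if "J \<subseteq> I" for J using that I finite_subset by blast
      have eqc: "(\<Sum>u\<in>words k J. of_bool (glue J u ?w \<in> D))
          = dens k J {u. glue J u ?w \<in> D} * real k ^ card J" if "J \<subseteq> I" for J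
        using k by (simp add: avg_def)
      have one: "dens k J A \<le> 1" if "J \<subseteq> I" for J A
        using k fin[OF that] by (intro avg_le) auto
      have "e * real (Suc k) ^ card I \<le> (\<Sum>x\<in>words (Suc k) I. of_bool (x \<in> D))"
        using dens by (simp add: avg_def field_simps)
      also have "\<dots> = (\<Sum>J\<in>Pow I. dens k J {u. glue J u ?w \<in> D} * real k ^ card J)"
        unfolding sum_words_Suc[OF I(1)] by (intro sum.cong refl eqc) auto
      also have "\<dots> \<le> (\<Sum>J\<in>Pow I. e / 2 * real k ^ card J + (if card J < m then real k ^ card J else 0))"
      proof (intro sum_mono)
        fix J assume J: "J \<in> Pow I"
        show "dens k J {u. glue J u ?w \<in> D} * real k ^ card J
            \<le> e / 2 * real k ^ card J + (if card J < m then real k ^ card J else 0)"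
        proof (cases "card J < m")
          case True
          have "dens k J {u. glue J u ?w \<in> D} * real k ^ card J \<le> 1 * real k ^ card J"
            using one[of J "{u. glue J u ?w \<in> D}"] J by (intro mult_right_mono) auto
          moreover have "0 \<le> e / 2 * real k ^ card J" using e by simp
          ultimately show ?thesis using True by simp
        next
          case False
          have "dens k J {u. glue J u ?w \<in> D} * real k ^ card J \<le> e / 2 * real k ^ card J"
            using small[of J] J False by (intro mult_right_mono) auto
          then show ?thesis using False by simp
        qed
      qed
      also have "\<dots> = e / 2 * (\<Sum>J\<in>Pow I. real k ^ card J) + (\<Sum>J\<in>?S. real k ^ card J)"
      proof -
        have S: "?S = {J \<in> Pow I. card J < m}" by auto
        show ?thesis unfolding S
          using I by (subst sum.inter_filter) (simp_all add: sum.distrib sum_distrib_left)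
      qed
      also have "(\<Sum>J\<in>Pow I. real k ^ card J) = real (Suc k) ^ card I"
      proof -
        have "(\<Sum>J\<in>Pow I. real k ^ card J) = (\<Sum>J\<in>Pow I. \<Sum>u\<in>words k J. 1)"
          using fin by (intro sum.cong) (auto simp: card_words)
        also have "\<dots> = (\<Sum>x\<in>words (Suc k) I. 1)" unfolding sum_words_Suc[OF I(1)] ..
        finally show ?thesis using I by (simp add: card_words)
      qed
      finally show False using n[OF I] by simp
    qed
    then obtain J where J: "J \<subseteq> I" "m \<le> card J" "e / 2 \<le> dens k J {u. glue J u ?w \<in> D}" by blast
    have finJ: "finite J" using J I finite_subset by blast
    from m[OF finJ J(2,3)] obtain \<sigma> where \<sigma>: "comb_subspace k d J \<sigma>"
      and \<sigma>D: "\<And>u. u \<in> words k {..<d} \<Longrightarrow> glue J (plug \<sigma> u) ?w \<in> D"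
      unfolding has_subspace_def by auto
    define \<rho> where "\<rho> t = (if t \<in> J then \<sigma> t else Inl (?w t))" for t
    have \<rho>: "comb_subspace (Suc k) d I \<rho>"
    proof (rule comb_subspaceI)
      fix j assume "j < d"
      then obtain t where "t \<in> J" "\<sigma> t = Inr j" using comb_subspaceD(5)[OF \<sigma>] by blast
      then show "\<exists>t\<in>I. \<rho> t = Inr j" using J by (intro bexI[of _ t]) (auto simp: \<rho>_def)
    next
      fix t a assume "t \<in> I" "\<rho> t = Inl a"
      then show "a < Suc k"
        using comb_subspaceD(1)[OF \<sigma>, of t a] by (auto simp: \<rho>_def split: if_splits)
    qed (use comb_subspaceD(2)[OF \<sigma>] J in \<open>auto simp: \<rho>_def split: if_splits\<close>)
    have plug: "plug \<rho> u = glue J (plug \<sigma> u) ?w" for u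
      by (auto simp: plug_def glue_def \<rho>_def)
    have "plug \<rho> u \<in> D" if u: "u \<in> words (Suc k) {..<d}" for u
    proof -
      let ?u = "replace_letter k i u"
      have u': "?u \<in> words k {..<d}" using replace_letter_words[OF k i u] .
      then have "?u \<in> words (Suc k) {..<d}" using words_mono[of k "Suc k"] by auto
      moreover have "replace_letter k i ?u = replace_letter k i u"
        using i by (auto simp: replace_letter_def)
      ultimately have "plug \<rho> ?u \<in> D \<longleftrightarrow> plug \<rho> u \<in> D"
        using insensitiveD[OF ins plug_words[OF \<rho>] plug_words[OF \<rho> u] replace_letter_plug_cong] by simp
      then show ?thesis using \<sigma>D[OF u'] plug by simp
    qed
    with \<rho> show "has_subspace (Suc k) d I D" by (auto simp: has_subspace_def)
  qed
qed

section \<open>Averages over intersections of insensitive sets\<close>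

definition subspace_avg_le :: "nat \<Rightarrow> nat \<Rightarrow> nat set \<Rightarrow> ((nat \<Rightarrow> nat) \<Rightarrow> real) \<Rightarrow> real \<Rightarrow> bool" where
  "subspace_avg_le k d I f c \<longleftrightarrow>
     (\<forall>\<sigma>. comb_subspace k d I \<sigma> \<longrightarrow> avg k {..<d} (\<lambda>u. f (plug \<sigma> u)) \<le> c)"

lemma subspace_avg_le_slice:
  assumes "subspace_avg_le k d (I \<union> J) f c" "x \<in> words k I" "I \<inter> J = {}"
  shows "subspace_avg_le k d J (\<lambda>y. f (glue I x y)) c"
  unfolding subspace_avg_le_def
proof (intro allI impI)
  fix \<tau> assume "comb_subspace k d J \<tau>"
  from comb_subspace_glue_left[OF this assms(2,3)] assms(1)
  show "avg k {..<d} (\<lambda>u. f (glue I x (plug \<tau> u))) \<le> c"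
    unfolding subspace_avg_le_def by (metis (no_types, lifting) avg_cong plug_glue_left)
qed

lemma subspace_avg_le_plug:
  assumes "subspace_avg_le k e I f c" "comb_subspace k d I \<sigma>"
  shows "subspace_avg_le k e {..<d} (\<lambda>u. f (plug \<sigma> u)) c"
  unfolding subspace_avg_le_def
proof (intro allI impI)
  fix \<tau> assume "comb_subspace k e {..<d} \<tau>"
  from comb_subspace_comp[OF assms(2) this] assms(1)
  show "avg k {..<e} (\<lambda>u. f (plug \<sigma> (plug \<tau> u))) \<le> c"
    unfolding subspace_avg_le_def by (simp flip: plug_comp)
qed

lemma avg_on_subspace:
  assumes "comb_subspace k d I \<sigma>" "finite I" "0 < k"
  shows "avg k I (\<lambda>x. of_bool (x \<in> plug \<sigma> ` words k {..<d}) * f x)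
    = real k ^ d / real k ^ card I * avg k {..<d} (\<lambda>u. f (plug \<sigma> u))"
proof -
  let ?U = "plug \<sigma> ` words k {..<d}"
  have sub: "?U \<subseteq> words k I" using plug_words[OF assms(1)] by auto
  have "(\<Sum>x\<in>words k I. of_bool (x \<in> ?U) * f x) = (\<Sum>x\<in>?U. f x)"
    using sub assms(2) by (intro sum.mono_neutral_cong_right) auto
  also have "\<dots> = (\<Sum>u\<in>words k {..<d}. f (plug \<sigma> u))"
    using inj_on_plug[OF assms(1)] by (simp add: sum.reindex)
  finally show ?thesis using assms(3) by (simp add: avg_def)
qed

text \<open>An insensitive set is, up to a small error, a disjoint union of \<open>d\<close>-dimensional subspaces, and on
each of these the average of \<open>f\<close> is at most \<open>e\<close>. The subspaces are removed block by block: on the first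
block of \<open>m\<close> positions, every dense slice \<open>E z\<close> contains a subspace \<open>U (E z)\<close>, chosen as a function of the
slice. Since equivalent \<open>z\<close> have the same slice, what is left remains insensitive in the
remaining positions, and the procedure is repeated there. Each round removes at least the fraction
\<open>\<rho>\<close> of what is left, unless this already has density at most \<open>e\<close>.\<close>

lemma insensitive_avg_le:
  assumes k: "0 < k" and M: "density_HJ k d" and e: "0 < e" "e \<le> 1"
  shows "\<exists>n. \<forall>I f D i. finite I \<longrightarrow> n \<le> card I \<longrightarrow> i < k \<longrightarrow> (\<forall>x. f x \<le> 1) \<longrightarrow>
    subspace_avg_le (Suc k) d I f e \<longrightarrow> insensitive k i I D \<longrightarrow>
    avg (Suc k) I (\<lambda>x. of_bool (x \<in> D) * f x) \<le> 3 * e"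
proof -
  let ?K = "Suc k"
  obtain m where m: "\<And>I D i. finite I \<Longrightarrow> m \<le> card I \<Longrightarrow> i < k \<Longrightarrow> insensitive k i I D \<Longrightarrow>
    e / 2 \<le> dens ?K I D \<Longrightarrow> has_subspace ?K d I D"
    using insensitive_has_subspace[OF k M, of "e / 2"] e by auto
  define \<rho> where "\<rho> = e / 2 / real ?K ^ m"
  have "\<rho> \<le> e / 2 / 1" unfolding \<rho>_def using e by (intro divide_left_mono) auto
  moreover have "0 < \<rho>" unfolding \<rho>_def using e by simp
  ultimately have \<rho>: "0 < \<rho>" "\<rho> < 1" using e by auto
  \<comment> \<open>The three terms bound the removed subspaces, the case where the rest has become sparse, and what is
    left after \<open>s\<close> rounds. A bound linear in the density of \<open>D\<close> is preserved by averaging over slices.\<close>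
  have main: "avg ?K I (\<lambda>x. of_bool (x \<in> D) * f x) \<le> e * dens ?K I D + e + (1 - \<rho>) ^ s * dens ?K I D"
    if "finite I" "s * m \<le> card I" "i < k" "\<And>x. f x \<le> 1" "subspace_avg_le ?K d I f e"
      "insensitive k i I D" for s I f D i
    using that
  proof (induction s arbitrary: I f D)
    case 0
    have "avg ?K I (\<lambda>x. of_bool (x \<in> D) * f x) \<le> dens ?K I D"
      using 0 by (intro avg_mono) auto
    moreover have "0 \<le> dens ?K I D" by (intro avg_nonneg) auto
    ultimately show ?case using e by (simp add: add_nonneg_nonneg add_increasing)
  next
    case (Suc s)
    have le: "avg ?K I (\<lambda>x. of_bool (x \<in> D) * f x) \<le> dens ?K I D"
      using Suc.prems by (intro avg_mono) auto
    have D0: "0 \<le> dens ?K I D" by (intro avg_nonneg) auto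
    have D1: "dens ?K I D \<le> 1" using Suc.prems by (intro avg_le) auto
    show ?case
    proof (cases "dens ?K I D \<le> e")
      case True
      have "0 \<le> e * dens ?K I D + (1 - \<rho>) ^ Suc s * dens ?K I D"
        using D0 e \<rho> by (intro add_nonneg_nonneg mult_nonneg_nonneg zero_le_power) auto
      then show ?thesis using le True by linarith
    next
      case False
      obtain I1 I2 where I: "I = I1 \<union> I2" and dis: "I1 \<inter> I2 = {}" and fin: "finite I1" "finite I2"
        and cI: "card I1 = m" "s * m \<le> card I2"
        using split_index[of I m "s * m"] Suc.prems by auto
      have dis': "I2 \<inter> I1 = {}" using dis by auto
      note ins = Suc.prems(6)[unfolded I]
      define E where "E z = {x \<in> words ?K I1. glue I1 x z \<in> D}" for z
      define sel where "sel B = (SOME \<sigma>. comb_subspace ?K d I1 \<sigma> \<and> (\<forall>u\<in>words ?K {..<d}. plug \<sigma> u \<in> B))" for B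
      define U where "U B = (if has_subspace ?K d I1 B then plug (sel B) ` words ?K {..<d} else {})" for B
      have sel: "comb_subspace ?K d I1 (sel B)" "\<forall>u\<in>words ?K {..<d}. plug (sel B) u \<in> B"
        if "has_subspace ?K d I1 B" for B
        using someI_ex[OF that[unfolded has_subspace_def]] unfolding sel_def by auto
      have UB: "U B \<subseteq> B" for B using sel(2)[of B] by (auto simp: U_def)
      define D' where "D' x = {z. glue I1 x z \<in> D \<and> x \<notin> U (E z)}" for x
      have Eins: "insensitive k i I1 (E z)" if z: "z \<in> words ?K I2" for z
        unfolding insensitive_def
      proof (intro ballI impI)
        fix x y assume "x \<in> words ?K I1" "y \<in> words ?K I1"
          "replace_letter k i x = replace_letter k i y" "x \<in> E z"
        then show "y \<in> E z"
          using insensitiveD[OF ins glue_words[OF _ z] glue_words[OF _ z], of x y]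
          by (simp add: E_def replace_letter_glue)
      qed
      have Econg: "E z = E z'" if z: "z \<in> words ?K I2" "z' \<in> words ?K I2"
        "replace_letter k i z = replace_letter k i z'" for z z'
        using insensitiveD[OF ins glue_words glue_words, OF _ z(1) _ z(2)] z(3)
        by (auto simp: E_def replace_letter_glue)
      have D'ins: "insensitive k i I2 (D' x)" if x: "x \<in> words ?K I1" for x
        unfolding insensitive_def
      proof (intro ballI impI)
        fix z z' assume z: "z \<in> words ?K I2" "z' \<in> words ?K I2"
          "replace_letter k i z = replace_letter k i z'" and "z \<in> D' x"
        then show "z' \<in> D' x"
          using insensitiveD[OF ins glue_words[OF x z(1)] glue_words[OF x z(2)]] Econg[OF z]
          by (simp add: D'_def replace_letter_glue)
      qed
      have split: "of_bool (glue I1 x z \<in> D) = (of_bool (z \<in> D' x) + of_bool (x \<in> U (E z)) :: real)"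
        if "x \<in> words ?K I1" for x z
        using UB[of "E z"] by (auto simp: D'_def E_def)
      let ?\<delta>' = "avg ?K I1 (\<lambda>x. dens ?K I2 (D' x))"
      let ?u = "avg ?K I2 (\<lambda>z. dens ?K I1 (U (E z)))"
      have densD: "dens ?K I D = ?\<delta>' + ?u"
        unfolding I avg_glue[OF fin dis]
        by (subst (3) avg_swap) (simp add: split avg_add[symmetric] cong: avg_cong)
      have part1: "avg ?K I1 (\<lambda>x. avg ?K I2 (\<lambda>z. of_bool (z \<in> D' x) * f (glue I1 x z)))
          \<le> e * ?\<delta>' + e + (1 - \<rho>) ^ s * ?\<delta>'"
      proof -
        have "avg ?K I1 (\<lambda>x. avg ?K I2 (\<lambda>z. of_bool (z \<in> D' x) * f (glue I1 x z)))
          \<le> avg ?K I1 (\<lambda>x. e * dens ?K I2 (D' x) + e + (1 - \<rho>) ^ s * dens ?K I2 (D' x))"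
          using Suc.prems fin cI D'ins subspace_avg_le_slice[OF Suc.prems(5)[unfolded I] _ dis]
          by (intro avg_mono Suc.IH) auto
        also have "\<dots> = e * ?\<delta>' + e + (1 - \<rho>) ^ s * ?\<delta>'"
          using fin by (simp add: avg_add avg_cmult)
        finally show ?thesis .
      qed
      have part2: "avg ?K I2 (\<lambda>z. avg ?K I1 (\<lambda>x. of_bool (x \<in> U (E z)) * f (glue I1 x z))) \<le> e * ?u"
      proof (subst avg_cmult[symmetric], intro avg_mono)
        fix z assume z: "z \<in> words ?K I2"
        have "avg ?K I1 (\<lambda>x. of_bool (x \<in> U (E z)) * f (glue I1 x z)) =
              avg ?K I1 (\<lambda>x. of_bool (x \<in> U (E z)) * f (glue I2 z x))"
          using glue_commute[OF _ z dis] by (auto intro!: avg_cong)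
        also have "\<dots> \<le> e * dens ?K I1 (U (E z))"
        proof (cases "has_subspace ?K d I1 (E z)")
          case True
          note s = sel(1)[OF True]
          have "subspace_avg_le ?K d I1 (\<lambda>x. f (glue I2 z x)) e"
            using subspace_avg_le_slice[OF _ z dis', of d f e] Suc.prems(5) by (simp add: I Un_commute)
          then have *: "avg ?K {..<d} (\<lambda>u. f (glue I2 z (plug (sel (E z)) u))) \<le> e"
            using s unfolding subspace_avg_le_def by blast
          have "dens ?K I1 (U (E z)) = real ?K ^ d / real ?K ^ card I1"
            using avg_on_subspace[OF s fin(1), of "\<lambda>_. 1"] True by (simp add: U_def)
          moreover have "avg ?K I1 (\<lambda>x. of_bool (x \<in> U (E z)) * f (glue I2 z x))
            = real ?K ^ d / real ?K ^ card I1 * avg ?K {..<d} (\<lambda>u. f (glue I2 z (plug (sel (E z)) u)))"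
            using avg_on_subspace[OF s fin(1)] True by (simp add: U_def)
          moreover have "real ?K ^ d / real ?K ^ card I1 * avg ?K {..<d} (\<lambda>u. f (glue I2 z (plug (sel (E z)) u)))
            \<le> real ?K ^ d / real ?K ^ card I1 * e"
            using * by (intro mult_left_mono) auto
          ultimately show ?thesis by (simp only: mult.commute)
        qed (simp add: U_def fin)
        finally show "avg ?K I1 (\<lambda>x. of_bool (x \<in> U (E z)) * f (glue I1 x z)) \<le> e * dens ?K I1 (U (E z))" .
      qed
      have ularge: "\<rho> \<le> ?u"
      proof -
        have "e \<le> avg ?K I2 (\<lambda>z. dens ?K I1 (E z))"
          using False unfolding I avg_glue[OF fin dis]
          by (subst (asm) avg_swap) (simp add: E_def cong: avg_cong)
        then have "e / 2 \<le> avg ?K I2 (\<lambda>z. of_bool (e / 2 \<le> dens ?K I1 (E z)))"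
          using fin e by (intro avg_many_large avg_le) auto
        moreover have "\<rho> = 1 / real ?K ^ m * (e / 2)" by (simp add: \<rho>_def)
        ultimately have "\<rho> \<le> 1 / real ?K ^ m * avg ?K I2 (\<lambda>z. of_bool (e / 2 \<le> dens ?K I1 (E z)))"
          by (simp only:) (intro mult_left_mono, auto)
        also have "\<dots> \<le> ?u"
        proof (subst avg_cmult[symmetric], intro avg_mono)
          fix z assume z: "z \<in> words ?K I2"
          show "1 / real ?K ^ m * of_bool (e / 2 \<le> dens ?K I1 (E z)) \<le> dens ?K I1 (U (E z))"
          proof (cases "e / 2 \<le> dens ?K I1 (E z)")
            case True
            then have h: "has_subspace ?K d I1 (E z)"
              using m[OF fin(1) _ Suc.prems(3) Eins[OF z]] cI by simp
            have "1 \<le> real ?K ^ d" by simp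
            then have "1 / real ?K ^ m \<le> real ?K ^ d / real ?K ^ m" by (intro divide_right_mono) auto
            moreover have "dens ?K I1 (U (E z)) = real ?K ^ d / real ?K ^ m"
              using avg_on_subspace[OF sel(1)[OF h] fin(1), of "\<lambda>_. 1"] h cI by (simp add: U_def)
            ultimately show ?thesis using True by simp
          qed (simp add: avg_nonneg)
        qed
        finally show ?thesis .
      qed
      have "avg ?K I (\<lambda>x. of_bool (x \<in> D) * f x)
          = avg ?K I1 (\<lambda>x. avg ?K I2 (\<lambda>z. of_bool (z \<in> D' x) * f (glue I1 x z)))
          + avg ?K I1 (\<lambda>x. avg ?K I2 (\<lambda>z. of_bool (x \<in> U (E z)) * f (glue I1 x z)))"
        unfolding I avg_glue[OF fin dis]
        by (simp add: split avg_add[symmetric] distrib_right cong: avg_cong)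
      also have "\<dots> \<le> (e * ?\<delta>' + e + (1 - \<rho>) ^ s * ?\<delta>') + e * ?u"
        using part1 part2 by (subst (2) avg_swap) (rule add_mono)
      also have "\<dots> = e * dens ?K I D + e + (1 - \<rho>) ^ s * ?\<delta>'"
        using densD by (simp add: algebra_simps)
      also have "\<dots> \<le> e * dens ?K I D + e + (1 - \<rho>) ^ s * ((1 - \<rho>) * dens ?K I D)"
      proof -
        have "\<rho> * dens ?K I D \<le> \<rho>" using D1 \<rho> by (simp add: mult_left_le)
        then have "?\<delta>' \<le> (1 - \<rho>) * dens ?K I D" using densD ularge by (simp add: algebra_simps)
        then show ?thesis using \<rho> by (simp add: mult_left_mono)
      qed
      finally show ?thesis by (simp add: mult.assoc mult.left_commute)
    qed
  qed
  obtain s where s: "(1 - \<rho>) ^ s < e"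
    using real_arch_pow_inv[of e "1 - \<rho>"] e \<rho> by auto
  show ?thesis
  proof (intro exI[of _ "s * m"] allI impI)
    fix I f D i assume *: "finite I" "s * m \<le> card I" "i < k" "\<forall>x. f x \<le> 1"
      "subspace_avg_le ?K d I f e" "insensitive k i I D"
    have D0: "0 \<le> dens ?K I D" by (intro avg_nonneg) auto
    have D1: "dens ?K I D \<le> 1" using * by (intro avg_le) auto
    have "avg ?K I (\<lambda>x. of_bool (x \<in> D) * f x) \<le> e * dens ?K I D + e + (1 - \<rho>) ^ s * dens ?K I D"
      using * by (intro main) auto
    also have "\<dots> \<le> e * 1 + e + e * 1"
      using D0 D1 e s by (intro add_mono mult_mono) auto
    finally show "avg ?K I (\<lambda>x. of_bool (x \<in> D) * f x) \<le> 3 * e" by simp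
  qed
qed

text \<open>Induction on the number of sets: the last set is decomposed into subspaces of a dimension so high that
the bound for the first \<open>l\<close> sets applies inside each of them.\<close>

lemma insensitive_inter_avg_le:
  assumes k: "0 < k" and M: "\<And>d. density_HJ k d" and e: "0 < e" and l: "l \<le> k"
  shows "\<exists>n. \<forall>I f D. finite I \<longrightarrow> n \<le> card I \<longrightarrow> (\<forall>x. f x \<le> 1) \<longrightarrow>
    subspace_avg_le (Suc k) d I f 0 \<longrightarrow> (\<forall>i<l. insensitive k i I (D i)) \<longrightarrow>
    avg (Suc k) I (\<lambda>x. of_bool (\<forall>i<l. x \<in> D i) * f x) \<le> e"
  using e l
proof (induction l arbitrary: e)
  case 0
  define e' where "e' = min 1 (e / 3)"
  have e': "0 < e'" "e' \<le> 1" "3 * e' \<le> e" using 0 by (auto simp: e'_def)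
  obtain n where n: "\<And>I f D i. finite I \<Longrightarrow> n \<le> card I \<Longrightarrow> i < k \<Longrightarrow> (\<forall>x. f x \<le> 1) \<Longrightarrow>
    subspace_avg_le (Suc k) d I f e' \<Longrightarrow> insensitive k i I D \<Longrightarrow>
    avg (Suc k) I (\<lambda>x. of_bool (x \<in> D) * f x) \<le> 3 * e'"
    using insensitive_avg_le[OF k M[of d] e'(1,2)] by blast
  show ?case
  proof (intro exI[of _ n] allI impI)
    fix I f and D :: "nat \<Rightarrow> (nat \<Rightarrow> nat) set"
    assume *: "finite I" "n \<le> card I" "\<forall>x. f x \<le> 1" "subspace_avg_le (Suc k) d I f 0"
    have "subspace_avg_le (Suc k) d I f e'"
      using *(4) e' unfolding subspace_avg_le_def by force
    then have "avg (Suc k) I (\<lambda>x. of_bool (x \<in> UNIV) * f x) \<le> 3 * e'"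
      using * k by (intro n[of I 0]) (auto simp: insensitive_def)
    then show "avg (Suc k) I (\<lambda>x. of_bool (\<forall>i<0. x \<in> D i) * f x) \<le> e" using e' by simp
  qed
next
  case (Suc l)
  define e' where "e' = min 1 (e / 3)"
  have e': "0 < e'" "e' \<le> 1" "3 * e' \<le> e" using Suc by (auto simp: e'_def)
  obtain d1 where d1: "\<And>I f D. finite I \<Longrightarrow> d1 \<le> card I \<Longrightarrow> (\<forall>x. f x \<le> 1) \<Longrightarrow>
    subspace_avg_le (Suc k) d I f 0 \<Longrightarrow> (\<forall>i<l. insensitive k i I (D i)) \<Longrightarrow>
    avg (Suc k) I (\<lambda>x. of_bool (\<forall>i<l. x \<in> D i) * f x) \<le> e'"
    using Suc.IH[OF e'(1)] Suc.prems(2) Suc_leD by blast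
  obtain n where n: "\<And>I f D i. finite I \<Longrightarrow> n \<le> card I \<Longrightarrow> i < k \<Longrightarrow> (\<forall>x. f x \<le> 1) \<Longrightarrow>
    subspace_avg_le (Suc k) d1 I f e' \<Longrightarrow> insensitive k i I D \<Longrightarrow>
    avg (Suc k) I (\<lambda>x. of_bool (x \<in> D) * f x) \<le> 3 * e'"
    using insensitive_avg_le[OF k M[of d1] e'(1,2)] by blast
  show ?case
  proof (intro exI[of _ n] allI impI)
    fix I f and D :: "nat \<Rightarrow> (nat \<Rightarrow> nat) set"
    assume *: "finite I" "n \<le> card I" "\<forall>x. f x \<le> 1" "subspace_avg_le (Suc k) d I f 0"
      "\<forall>i<Suc l. insensitive k i I (D i)"
    define g where "g x = of_bool (\<forall>i<l. x \<in> D i) * f x" for x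
    have g_le: "g x \<le> 1" for x using *(3) by (simp add: g_def)
    have "subspace_avg_le (Suc k) d1 I g e'"
      unfolding subspace_avg_le_def
    proof (intro allI impI)
      fix \<sigma> assume \<sigma>: "comb_subspace (Suc k) d1 I \<sigma>"
      have "avg (Suc k) {..<d1} (\<lambda>u. of_bool (\<forall>i<l. u \<in> {u. plug \<sigma> u \<in> D i}) * f (plug \<sigma> u)) \<le> e'"
        using * subspace_avg_le_plug[OF *(4) \<sigma>] insensitive_plug[OF _ \<sigma>]
        by (intro d1) auto
      then show "avg (Suc k) {..<d1} (\<lambda>u. g (plug \<sigma> u)) \<le> e'" by (simp add: g_def)
    qed
    then have "avg (Suc k) I (\<lambda>x. of_bool (x \<in> D l) * g x) \<le> 3 * e'"
      using * Suc.prems by (intro n[of I l]) (auto simp: g_le)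
    also have "(\<lambda>x. of_bool (x \<in> D l) * g x) = (\<lambda>x. of_bool (\<forall>i<Suc l. x \<in> D i) * f x)"
      by (simp add: g_def All_less_Suc of_bool_conj mult.assoc)
    finally show "avg (Suc k) I (\<lambda>x. of_bool (\<forall>i<Suc l. x \<in> D i) * f x) \<le> e" using e' by simp
  qed
qed

section \<open>The critical density of line-free sets\<close>

abbreviation line_free :: "nat \<Rightarrow> nat set \<Rightarrow> (nat \<Rightarrow> nat) set \<Rightarrow> bool" where
  "line_free k I A \<equiv> \<not> has_subspace k 1 I A"

text \<open>The critical density is the infimum of the asymptotic upper bounds for the density of line-free sets.
It is positive because the failure of the theorem provides line-free sets of density at least some \<open>\<delta> > 0\<close> in
arbitrarily high dimension.\<close>

lemma critical_density:
  assumes k: "0 < k" and no: "\<not> density_HJ k 1"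
  obtains \<alpha> where "0 < \<alpha>"
    "\<And>e. 0 < e \<Longrightarrow> \<exists>n. \<forall>I A. finite I \<longrightarrow> n \<le> card I \<longrightarrow> line_free k I A \<longrightarrow> dens k I A \<le> \<alpha> + e"
    "\<And>e n. 0 < e \<Longrightarrow> \<exists>I A. finite I \<and> n \<le> card I \<and> line_free k I A \<and> \<alpha> - e \<le> dens k I A"
proof -
  define S where "S = {s. \<exists>n. \<forall>I A. finite I \<longrightarrow> n \<le> card I \<longrightarrow> line_free k I A \<longrightarrow> dens k I A \<le> s}"
  obtain \<delta> where \<delta>0: "0 < \<delta>" and no':
    "\<nexists>n. \<forall>I A. finite I \<longrightarrow> n \<le> card I \<longrightarrow> \<delta> \<le> dens k I A \<longrightarrow> has_subspace k 1 I A"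
    using no unfolding density_HJ_def not_all not_imp by (elim exE conjE)
  have \<delta>: "\<exists>I A. finite I \<and> n \<le> card I \<and> \<delta> \<le> dens k I A \<and> line_free k I A" for n
    using spec[OF no'[unfolded not_ex], of n] by (simp only: not_all not_imp)
  have lower: "\<delta> \<le> s" if "s \<in> S" for s
  proof -
    obtain n where n: "\<And>I A. finite I \<Longrightarrow> n \<le> card I \<Longrightarrow> line_free k I A \<Longrightarrow> dens k I A \<le> s"
      using \<open>s \<in> S\<close> unfolding S_def by blast
    obtain I A where "finite I" "n \<le> card I" "\<delta> \<le> dens k I A" "line_free k I A"
      using \<delta>[of n] by (elim exE conjE)
    with n[of I A] show ?thesis by linarith
  qed
  have "dens k I A \<le> 1" if "finite I" for I A using k that by (intro avg_le) auto
  then have "1 \<in> S" unfolding S_def by auto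
  then have ne: "S \<noteq> {}" by blast
  have bdd: "bdd_below S" using lower by (auto simp: bdd_below_def)
  show ?thesis
  proof (rule that[of "Inf S"])
    show "0 < Inf S" using cInf_greatest[OF ne lower] \<delta>0 by linarith
  next
    fix e :: real assume "0 < e"
    then obtain s where s: "s \<in> S" "s < Inf S + e" using cInf_lessD[OF ne, of "Inf S + e"] by auto
    from s(1) obtain n where
      n: "\<forall>I A. finite I \<longrightarrow> n \<le> card I \<longrightarrow> line_free k I A \<longrightarrow> dens k I A \<le> s"
      unfolding S_def mem_Collect_eq by (elim exE)
    show "\<exists>n. \<forall>I A. finite I \<longrightarrow> n \<le> card I \<longrightarrow> line_free k I A \<longrightarrow> dens k I A \<le> Inf S + e"
    proof (intro exI[of _ n] allI impI)
      fix I A assume "finite I" "n \<le> card I" "line_free k I A"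
      then have "dens k I A \<le> s" using n by simp
      then show "dens k I A \<le> Inf S + e" using s(2) by simp
    qed
  next
    fix e :: real and n assume "0 < e"
    have "Inf S - e \<notin> S" using cInf_lower[OF _ bdd, of "Inf S - e"] \<open>0 < e\<close> by auto
    then have "\<nexists>n. \<forall>I A. finite I \<longrightarrow> n \<le> card I \<longrightarrow> line_free k I A \<longrightarrow> dens k I A \<le> Inf S - e"
      unfolding S_def mem_Collect_eq .
    from spec[OF this[unfolded not_ex], of n]
    have "\<not> (\<forall>I A. finite I \<longrightarrow> n \<le> card I \<longrightarrow> line_free k I A \<longrightarrow> dens k I A \<le> Inf S - e)" .
    then obtain I A where "finite I" "n \<le> card I" "line_free k I A" "Inf S - e < dens k I A"
      unfolding not_all not_imp not_le by (elim exE conjE)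
    then show "\<exists>I A. finite I \<and> n \<le> card I \<and> line_free k I A \<and> Inf S - e \<le> dens k I A"
      using less_imp_le by (intro exI conjI)
  qed
qed

lemma equal_fibres:
  assumes "finite I" "finite C" "card I = p * card C"
  obtains c where "\<And>b. b \<in> C \<Longrightarrow> card {i \<in> I. c i = b} = p"
proof -
  have eq: "card I = card ({..<p} \<times> C)" and fin: "finite ({..<p} \<times> C)" using assms by simp_all
  obtain h where h: "bij_betw h I ({..<p} \<times> C)"
    using finite_same_card_bij[OF assms(1) fin eq] by (elim exE)
  show ?thesis
  proof (rule that[of "\<lambda>i. snd (h i)"])
    fix b assume "b \<in> C"
    have "h ` {i \<in> I. snd (h i) = b} = {z \<in> h ` I. snd z = b}" by blast
    also have "\<dots> = {..<p} \<times> {b}"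
      using \<open>b \<in> C\<close> bij_betw_imp_surj_on[OF h] by auto
    finally have "h ` {i \<in> I. snd (h i) = b} = {..<p} \<times> {b}" .
    moreover have "inj_on h {i \<in> I. snd (h i) = b}"
      using inj_on_subset[OF bij_betw_imp_inj_on[OF h]] by auto
    ultimately show "card {i \<in> I. snd (h i) = b} = p"
      using card_image[of h "{i \<in> I. snd (h i) = b}"] by simp
  qed
qed

lemma line_free_slice:
  assumes "line_free k (I \<union> J) A" "x \<in> words k I" "I \<inter> J = {}"
  shows "line_free k J {y. glue I x y \<in> A}"
  using has_subspace_slice[OF _ assms(2,3)] assms(1) by auto

lemma insensitive_Compl:
  assumes "insensitive k i I D" shows "insensitive k i I (- D)"
  unfolding insensitive_def
proof (intro ballI impI)
  fix x y assume "x \<in> words (Suc k) I" "y \<in> words (Suc k) I"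
    "replace_letter k i x = replace_letter k i y" "x \<in> - D"
  with insensitiveD[OF assms, of x y] show "y \<in> - D" by simp
qed

lemma insensitive_UNIV: "insensitive k i I UNIV"
  by (simp add: insensitive_def)

section \<open>Line-free sets of nearly critical density\<close>

text \<open>Let \<open>A\<close> be line-free of nearly critical density over \<open>I = I1 \<union> I2\<close>, with \<open>I2\<close> much longer than \<open>I1\<close>. By
maximality every slice of \<open>A\<close> over a word on \<open>I1\<close> has nearly critical density in \<open>I2\<close>; hence averages
of \<open>A\<close> are nearly \<open>\<alpha>\<close> for \<^emph>\<open>any\<close> distribution of the \<open>I1\<close> part, and one may choose the one that suits
best.

That distribution is as follows. Each position \<open>i\<close> in \<open>I1\<close> carries a map \<open>c i\<close> from the \<open>k + 1\<close> letters
to a bounded index set \<open>{..<M}\<close>, every map being used \<open>P\<close> times. For a word \<open>w\<close> over \<open>{..<M}\<close> and a uniformly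
random word \<open>q\<close> let \<open>\<Phi> w q\<close> have the letter \<open>w (c i (q i))\<close> at \<open>i\<close>
and agree with \<open>q\<close> on \<open>I2\<close>. For fixed \<open>q\<close> this depends on \<open>w\<close> letter
by letter, so it commutes with replacing \<open>k\<close> by \<open>i\<close>; since \<open>w\<close> may range over words in the first \<open>k\<close>
letters only, the induction hypothesis in dimension \<open>M\<close> yields for many \<open>q\<close> a word \<open>w\<close> that uses all
\<open>k + 1\<close> letters and whose \<open>k\<close> replacements are all mapped into \<open>A\<close>. One word \<open>w0\<close> serves for a
proportion \<open>\<theta>\<close> of all \<open>q\<close>, and \<open>\<theta>\<close> depends only on \<open>k\<close> and \<open>\<alpha>\<close>.

Let \<open>b\<close> be a section of \<open>w0\<close>. At the positions of \<open>J = {i. c i = b}\<close> the letter of \<open>\<Phi> w0 q\<close> is \<open>q i\<close> itself. So,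
once \<open>q\<close> is fixed outside \<open>J\<close>, the word \<open>\<Phi> w0 q\<close> runs uniformly through a subspace of dimension \<open>P\<close>, and
the words \<open>q\<close> on \<open>J\<close> for which the \<open>i\<close>-th replacement lies in \<open>A\<close> form an insensitive set \<open>D i\<close>. If
\<open>\<Phi> w0 q\<close> were in \<open>A\<close> together with all its replacements, these words would form a line in \<open>A\<close>.\<close>

lemma dense_obstruction:
  assumes k: "0 < k" and M: "density_HJ k (Suc k)" and \<alpha>: "0 < \<alpha>"
    and upper: "\<And>e. 0 < e \<Longrightarrow> \<exists>n. \<forall>I A. finite I \<longrightarrow> n \<le> card I \<longrightarrow> line_free (Suc k) I A \<longrightarrow>
      dens (Suc k) I A \<le> \<alpha> + e"
    and lower: "\<And>e n. 0 < e \<Longrightarrow> \<exists>I A. finite I \<and> n \<le> card I \<and> line_free (Suc k) I A \<and>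
      \<alpha> - e \<le> dens (Suc k) I A"
  obtains \<theta> where "0 < \<theta>"
    "\<And>p \<gamma>. 0 < \<gamma> \<Longrightarrow> \<exists>J A D. finite J \<and> p \<le> card J \<and> \<alpha> - \<gamma> \<le> dens (Suc k) J A \<and> line_free (Suc k) J A \<and>
      (\<forall>i<k. insensitive k i J (D i)) \<and>
      \<theta> \<le> avg (Suc k) J (\<lambda>x. of_bool (\<forall>i<k. x \<in> D i)) \<and>
      (\<forall>x\<in>words (Suc k) J. x \<in> A \<longrightarrow> \<not> (\<forall>i<k. x \<in> D i))"
proof -
  let ?K = "Suc k"
  obtain M where M: "\<And>I A. finite I \<Longrightarrow> M \<le> card I \<Longrightarrow> \<alpha> / 4 \<le> dens k I A \<Longrightarrow> has_subspace k ?K I A"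
    using density_HJD[OF M, of "\<alpha> / 4"] \<alpha> by auto
  define \<theta> where "\<theta> = \<alpha> / 4 / real ?K ^ M"
  have \<theta>: "0 < \<theta>" using \<alpha> by (simp add: \<theta>_def)
  show ?thesis
  proof (rule that[of "\<theta> / 2"])
    show "0 < \<theta> / 2" using \<theta> by simp
    fix p :: nat and \<gamma> :: real assume \<gamma>: "0 < \<gamma>"
    \<comment> \<open>The weight \<open>c0\<close> combines two averages, so that one choice of the letters outside \<open>J\<close> makes both
      large. It is small against \<open>\<gamma>\<close>, and the error \<open>e1\<close> is small against \<open>c0 * \<theta>\<close>.\<close>
    define c0 where "c0 = \<gamma> / 2"
    define e1 where "e1 = min (min (\<gamma> / 2) (c0 * \<theta> / 4)) (\<alpha> / 2)"
    have c0: "0 < c0" using \<gamma> by (simp add: c0_def)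
    have e1: "0 < e1" "e1 \<le> \<gamma> / 2" "e1 \<le> c0 * \<theta> / 4" "e1 \<le> \<alpha> / 2"
      using \<gamma> c0 \<theta> \<alpha> by (auto simp: e1_def)
    obtain n1 where n1: "\<And>I A. finite I \<Longrightarrow> n1 \<le> card I \<Longrightarrow> line_free ?K I A \<Longrightarrow> dens ?K I A \<le> \<alpha> + e1"
      using upper[OF e1(1)] by blast
    define P where "P = max 1 (max p n1)"
    define C where "C = words M {..<?K}"
    have finC: "finite C" by (simp add: C_def)
    define m where "m = P * card C"
    \<comment> \<open>The factor lost in \<open>avg_all_large\<close> on the \<open>m\<close> positions of \<open>I1\<close> turns \<open>e2\<close> into \<open>e1\<close>.\<close>
    define e2 where "e2 = e1 / (2 * real ?K ^ m)"
    have e2: "0 < e2" "2 * real ?K ^ m * e2 = e1" using e1 by (auto simp: e2_def)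
    obtain n2 where n2: "\<And>I A. finite I \<Longrightarrow> n2 \<le> card I \<Longrightarrow> line_free ?K I A \<Longrightarrow> dens ?K I A \<le> \<alpha> + e2"
      using upper[OF e2(1)] by blast
    obtain I A where "finite I" "m + n2 \<le> card I" and lfA: "line_free ?K I A" and dA: "\<alpha> - e2 \<le> dens ?K I A"
      using lower[OF e2(1)] by blast
    then obtain I1 I2 where I: "I = I1 \<union> I2" and dis: "I1 \<inter> I2 = {}" and fin: "finite I1" "finite I2"
      and cI: "card I1 = m" "n2 \<le> card I2" using split_index by metis
    note lfA' = lfA[unfolded I]
    have slice: "\<alpha> - e1 \<le> dens ?K I2 {y. glue I1 x y \<in> A}" if x: "x \<in> words ?K I1" for x
    proof -
      have "\<alpha> - 2 * real ?K ^ card I1 * e2 \<le> dens ?K I2 {y. glue I1 x y \<in> A}"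
      proof (rule avg_all_large[OF fin(1) _ _ _ x])
        show "\<alpha> - e2 \<le> avg ?K I1 (\<lambda>x. dens ?K I2 {y. glue I1 x y \<in> A})"
          using dA by (simp add: I avg_glue[OF fin dis])
        show "dens ?K I2 {y. glue I1 x y \<in> A} \<le> \<alpha> + e2" if "x \<in> words ?K I1" for x
          using n2[OF fin(2) cI(2) line_free_slice[OF lfA' that dis]] .
      qed (use e2 in auto)
      then show ?thesis using e2 cI by simp
    qed
    obtain c where c: "\<And>b. b \<in> C \<Longrightarrow> card {i \<in> I1. c i = b} = P"
      using equal_fibres[OF fin(1) finC cI(1)[unfolded m_def]] by blast
    define \<Phi> where "\<Phi> w q = (\<lambda>i. if i \<in> I1 then w (c i (q i)) else q i)" for w q :: "nat \<Rightarrow> nat"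
    have \<Phi>_words: "\<Phi> w q \<in> words ?K I" if "w \<in> words ?K {..<M}" "q \<in> words ?K I" for w q
      using that words_less[OF that(1)] by (auto simp: words_def \<Phi>_def I)
    have \<Phi>_avg: "\<alpha> - e1 \<le> avg ?K I (\<lambda>q. of_bool (\<Phi> w q \<in> A))" if w: "w \<in> words ?K {..<M}" for w
      unfolding I avg_glue[OF fin dis]
    proof (rule avg_ge[OF fin(1)])
      fix \<psi> assume \<psi>: "\<psi> \<in> words ?K I1"
      define x where "x i = (if i \<in> I1 then w (c i (\<psi> i)) else 0)" for i
      have x: "x \<in> words ?K I1" using words_less[OF w] by (auto simp: words_def x_def)
      have "\<Phi> w (glue I1 \<psi> y) = glue I1 x y" for y by (auto simp: \<Phi>_def glue_def x_def)
      then show "\<alpha> - e1 \<le> avg ?K I2 (\<lambda>y. of_bool (\<Phi> w (glue I1 \<psi> y) \<in> A))" using slice[OF x] by simp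
    qed simp
    define W where "W = {w \<in> words ?K {..<M}. \<forall>j<?K. \<exists>b<M. w b = j}"
    have finW: "finite W" by (simp add: W_def)
    have "card W \<le> card (words ?K {..<M})" by (intro card_mono) (auto simp: W_def)
    then have cardW: "card W \<le> ?K ^ M" by (simp add: card_words)
    have finI: "finite I" using fin I by simp
    define good where "good q \<longleftrightarrow> \<alpha> / 4 \<le> dens k {..<M} {w. \<Phi> w q \<in> A}" for q
    have good_avg: "\<alpha> / 4 \<le> avg ?K I (\<lambda>q. of_bool (good q))"
    proof -
      have "\<alpha> / 2 \<le> avg k {..<M} (\<lambda>w. avg ?K I (\<lambda>q. of_bool (\<Phi> w q \<in> A)))"
      proof (rule avg_ge)
        fix w assume "w \<in> words k {..<M}"
        then have "w \<in> words ?K {..<M}" using words_mono[of k ?K] by auto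
        from \<Phi>_avg[OF this] show "\<alpha> / 2 \<le> avg ?K I (\<lambda>q. of_bool (\<Phi> w q \<in> A))" using e1 by simp
      qed (use k in auto)
      then have "\<alpha> / 2 \<le> avg ?K I (\<lambda>q. dens k {..<M} {w. \<Phi> w q \<in> A})"
        by (subst (asm) avg_swap) simp
      then have "\<alpha> / 2 / 2 \<le> avg ?K I (\<lambda>q. of_bool (\<alpha> / 2 / 2 \<le> dens k {..<M} {w. \<Phi> w q \<in> A}))"
        using finI k \<alpha> by (intro avg_many_large avg_le) auto
      then show ?thesis by (simp add: good_def)
    qed
    have goodW: "\<exists>w\<in>W. \<forall>i<k. \<Phi> (replace_letter k i w) q \<in> A" if "good q" for q
    proof -
      obtain \<sigma> where \<sigma>: "comb_subspace k ?K {..<M} \<sigma>"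
        and \<sigma>A: "\<And>u. u \<in> words k {..<?K} \<Longrightarrow> \<Phi> (plug \<sigma> u) q \<in> A"
        using M[of "{..<M}" "{w. \<Phi> w q \<in> A}"] \<open>good q\<close> unfolding good_def has_subspace_def by auto
      \<comment> \<open>The point of the subspace at which the variable \<open>j\<close> has the value \<open>j\<close>, now including \<open>j = k\<close>.\<close>
      define u where "u = (\<lambda>j. if j < ?K then j else 0)"
      have u: "u \<in> words ?K {..<?K}" by (auto simp: u_def words_def)
      have \<sigma>': "comb_subspace ?K ?K {..<M} \<sigma>"
        using \<sigma> unfolding comb_subspace_def by (fastforce split: sum.splits)
      have "\<exists>b<M. plug \<sigma> u b = j" if "j < ?K" for j
        using comb_subspaceD(5)[OF \<sigma> that] that by (force simp: plug_def u_def)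
      then have "plug \<sigma> u \<in> W" using plug_words[OF \<sigma>' u] by (simp add: W_def)
      moreover have "\<Phi> (replace_letter k i (plug \<sigma> u)) q \<in> A" if i: "i < k" for i
      proof -
        have "replace_letter k i (plug \<sigma> u) = plug \<sigma> (replace_letter k i u)"
        proof
          fix t show "replace_letter k i (plug \<sigma> u) t = plug \<sigma> (replace_letter k i u) t"
          proof (cases "\<sigma> t")
            case (Inl a)
            then have "a < k" using comb_subspaceD(1,4)[OF \<sigma>, of t] k by (cases "t < M") auto
            then show ?thesis using Inl by (simp add: replace_letter_def plug_def)
          qed (simp add: replace_letter_def plug_def)
        qed
        then show ?thesis using \<sigma>A[OF replace_letter_words[OF k i u]] by simp
      qed
      ultimately show ?thesis by blast
    qed
    have "W \<noteq> {}"
    proof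
      assume "W = {}"
      then have "\<not> good q" for q using goodW by blast
      then show False using good_avg finI \<alpha> by simp
    qed
    obtain w0 where w0: "w0 \<in> W"
      and w0_avg: "\<theta> \<le> avg ?K I (\<lambda>q. of_bool (\<forall>i<k. \<Phi> (replace_letter k i w0) q \<in> A))"
    proof -
      obtain w where w: "w \<in> W" "\<alpha> / 4 / card W \<le> avg ?K I (\<lambda>q. of_bool (\<forall>i<k. \<Phi> (replace_letter k i w) q \<in> A))"
        using avg_pigeonhole[OF finW \<open>W \<noteq> {}\<close> good_avg,
            of "\<lambda>w q. \<forall>i<k. \<Phi> (replace_letter k i w) q \<in> A"] goodW by blast
      have "0 < card W" using finW \<open>W \<noteq> {}\<close> by (simp add: card_gt_0_iff)
      moreover have "real (card W) \<le> real ?K ^ M" using cardW by (metis of_nat_le_iff of_nat_power)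
      ultimately have "\<theta> \<le> \<alpha> / 4 / card W"
        unfolding \<theta>_def using \<alpha> by (intro divide_left_mono) auto
      with w show ?thesis using that by fastforce
    qed
    have w0_words: "w0 \<in> words ?K {..<M}" using w0 by (simp add: W_def)
    define b where "b j = (if j < ?K then SOME s. s < M \<and> w0 s = j else 0)" for j
    have b: "b j < M" "w0 (b j) = j" if "j < ?K" for j
      using someI_ex[of "\<lambda>s. s < M \<and> w0 s = j"] w0 that by (auto simp: W_def b_def)
    have bC: "b \<in> C" using b(1) by (auto simp: C_def words_def b_def)
    define J where "J = {i \<in> I1. c i = b}"
    define R where "R = I - J"
    have J: "J \<subseteq> I1" "finite J" "card J = P" using fin c[OF bC] by (auto simp: J_def)
    have IJR: "I = J \<union> R" "J \<inter> R = {}" "finite R" using J I fin by (auto simp: R_def)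
    have \<Phi>_J: "\<Phi> w0 (glue J u v) = glue J u (\<Phi> w0 v)" if "u \<in> words ?K J" for u v
      using b(2) that J(1) by (auto simp: \<Phi>_def glue_def J_def words_def fun_eq_iff)
    let ?f = "\<lambda>v. avg ?K J (\<lambda>u. of_bool (\<Phi> w0 (glue J u v) \<in> A))"
    let ?g = "\<lambda>v. avg ?K J (\<lambda>u. of_bool (\<forall>i<k. \<Phi> (replace_letter k i w0) (glue J u v) \<in> A))"
    have "\<alpha> - e1 + c0 * \<theta> \<le> avg ?K R (\<lambda>v. ?f v + c0 * ?g v)"
    proof -
      have "\<alpha> - e1 \<le> avg ?K R ?f"
        using \<Phi>_avg[OF w0_words] unfolding IJR(1) avg_glue[OF J(2) IJR(3,2)] by (subst (asm) avg_swap)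
      moreover have "\<theta> \<le> avg ?K R ?g"
        using w0_avg unfolding IJR(1) avg_glue[OF J(2) IJR(3,2)] by (subst (asm) avg_swap)
      then have "c0 * \<theta> \<le> c0 * avg ?K R ?g" using c0 by simp
      ultimately show ?thesis by (simp add: avg_add avg_cmult)
    qed
    then obtain v where v: "v \<in> words ?K R" and fg: "\<alpha> - e1 + c0 * \<theta> \<le> ?f v + c0 * ?g v"
      using avg_ge_imp_ex[OF IJR(3)] by blast
    define r where "r = glue J (\<lambda>_. 0) (\<Phi> w0 v)"
    define A' where "A' = {u. glue J u r \<in> A}"
    define D where "D i = {u. \<Phi> (replace_letter k i w0) (glue J u v) \<in> A}" for i
    have r: "r \<in> words ?K R"
      using v words_less[OF w0_words] IJR by (auto simp: words_def r_def glue_def \<Phi>_def I)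
    have \<Phi>r: "\<Phi> w0 (glue J u v) = glue J u r" if "u \<in> words ?K J" for u
      unfolding \<Phi>_J[OF that] by (auto simp: glue_def r_def)
    have f_eq: "?f v = dens ?K J A'" using \<Phi>r by (auto simp: A'_def intro!: avg_cong)
    have g_eq: "?g v = avg ?K J (\<lambda>u. of_bool (\<forall>i<k. u \<in> D i))" by (simp add: D_def)
    have lfA2: "line_free ?K J A'"
    proof -
      have "A' \<inter> words ?K J = {u. glue R r u \<in> A} \<inter> words ?K J"
        using glue_commute[OF _ r IJR(2)] by (auto simp: A'_def)
      moreover have "line_free ?K J {u. glue R r u \<in> A}"
        using line_free_slice[of ?K R J A r] lfA r IJR by (simp add: Un_commute Int_commute)
      ultimately show ?thesis
        unfolding has_subspace_def using plug_words by blast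
    qed
    have f_le: "?f v \<le> \<alpha> + e1"
      unfolding f_eq using n1[OF J(2) _ lfA2] J(3) by (simp add: P_def)
    have g_le: "?g v \<le> 1" using J by (intro avg_le) auto
    have f_ge: "\<alpha> - \<gamma> \<le> ?f v"
    proof -
      have "c0 * ?g v \<le> c0" using g_le c0 by simp
      moreover have "0 \<le> c0 * \<theta>" using c0 \<theta> by simp
      ultimately show ?thesis using fg e1(2) unfolding c0_def by linarith
    qed
    have g_ge: "\<theta> / 2 \<le> ?g v"
    proof -
      have "c0 * (\<theta> / 2) \<le> c0 * ?g v" using fg f_le e1(3) by (simp add: algebra_simps)
      then show ?thesis using c0 by (simp only: mult_le_cancel_left_pos)
    qed
    have ins: "insensitive k i J (D i)" if i: "i < k" for i
      unfolding insensitive_def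
    proof (intro ballI impI)
      fix u u' assume u: "u \<in> words ?K J" "u' \<in> words ?K J" "replace_letter k i u = replace_letter k i u'" "u \<in> D i"
      have *: "\<Phi> (replace_letter k i w0) (glue J u v) = glue J (replace_letter k i u) (\<Phi> (replace_letter k i w0) v)"
        if u: "u \<in> words ?K J" for u
      proof
        fix t
        have "w0 (b (u t)) = u t" if "t \<in> J" using b(2)[of "u t"] u that by (auto simp: words_def)
        then show "\<Phi> (replace_letter k i w0) (glue J u v) t = glue J (replace_letter k i u) (\<Phi> (replace_letter k i w0) v) t"
          by (auto simp: \<Phi>_def glue_def J_def replace_letter_def)
      qed
      show "u' \<in> D i" using u unfolding D_def by (simp add: *)
    qed
    have disj: "\<not> (\<forall>i<k. u \<in> D i)" if u: "u \<in> words ?K J" and uA: "u \<in> A'" for u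
    proof
      assume uD: "\<forall>i<k. u \<in> D i"
      define q where "q = glue J u v"
      have q: "q \<in> words ?K I" using glue_words[OF u v] IJR(1) by (simp add: q_def)
      define x where "x = \<Phi> w0 q"
      have x: "x \<in> words ?K I" using \<Phi>_words[OF w0_words q] by (simp add: x_def)
      have xA: "x \<in> A" using uA \<Phi>r[OF u] by (simp add: x_def q_def A'_def)
      define \<tau> where "\<tau> t = (if t \<in> I1 \<and> x t = k then Inr (0::nat) else Inl (x t))" for t
      \<comment> \<open>The wildcard must occur: the map with constant value \<open>b k\<close> is among the \<open>c t\<close>, and at such
        a position the letter is \<open>w0 (b k) = k\<close>.\<close>
      have "\<exists>t\<in>I1. x t = k"
      proof -
        define c' where "c' j = (if j < ?K then b k else 0)" for j
        have c': "c' \<in> C" using b(1)[of k] by (auto simp: C_def words_def c'_def)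
        then have "card {t \<in> I1. c t = c'} \<noteq> 0" using c[OF c'] by (simp add: P_def)
        then obtain t where t: "t \<in> I1" "c t = c'" by (metis (mono_tags, lifting) card.empty empty_Collect_eq)
        have "q t < ?K" using words_less[OF q] by simp
        then have "x t = w0 (b k)" using t by (simp add: x_def \<Phi>_def c'_def)
        then show ?thesis using t b(2)[of k] by auto
      qed
      then have "comb_subspace ?K 1 I \<tau>"
        using x I by (intro comb_subspaceI) (auto simp: \<tau>_def words_def split: if_splits)
      moreover have "plug \<tau> a \<in> A" if a: "a \<in> words ?K {..<1}" for a
      proof (cases "a 0 = k")
        case True
        then have "plug \<tau> a = x" by (auto simp: plug_def \<tau>_def)
        then show ?thesis using xA by simp
      next
        case False
        then have "a 0 < k" using a by (auto simp: words_def less_Suc_eq)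
        moreover have "plug \<tau> a = \<Phi> (replace_letter k (a 0) w0) q"
          by (auto simp: plug_def \<tau>_def x_def \<Phi>_def replace_letter_def fun_eq_iff)
        ultimately show ?thesis using uD by (auto simp: D_def q_def)
      qed
      ultimately show False using lfA by (auto simp: has_subspace_def)
    qed
    show "\<exists>J A D. finite J \<and> p \<le> card J \<and> \<alpha> - \<gamma> \<le> dens ?K J A \<and> line_free ?K J A \<and>
      (\<forall>i<k. insensitive k i J (D i)) \<and>
      \<theta> / 2 \<le> avg ?K J (\<lambda>x. of_bool (\<forall>i<k. x \<in> D i)) \<and>
      (\<forall>x\<in>words ?K J. x \<in> A \<longrightarrow> \<not> (\<forall>i<k. x \<in> D i))"
      using J lfA2 ins disj f_ge[unfolded f_eq] g_ge[unfolded g_eq]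
      by (intro exI[of _ J] exI[of _ A'] exI[of _ D]) (auto simp: P_def)
  qed
qed

section \<open>The density Hales-Jewett theorem\<close>

text \<open>The complement of \<open>D\<^sub>0 \<inter> ... \<inter> D\<^bsub>k-1\<^esub>\<close> is the disjoint union over \<open>j\<close> of the sets
\<open>D\<^sub>0 \<inter> ... \<inter> D\<^bsub>j-1\<^esub> \<inter> - D\<^sub>j\<close>, each an intersection of insensitive sets. On subspaces the balanced
function \<open>f = 1\<^sub>A - (\<alpha> + \<beta>)\<close> has nonpositive averages, hence on these pieces its total is at most \<open>\<beta>\<close>. But
\<open>A\<close> lies in the complement, which has density at most \<open>1 - \<theta>\<close>, so that the total is about \<open>\<alpha> * \<theta> = 4 * \<beta>\<close>,
with errors adding up to at most \<open>2 * \<beta>\<close>.\<close>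

lemma density_HJ_Suc_letter:
  assumes k: "0 < k" and 1: "density_HJ k 1"
  shows "density_HJ (Suc k) 1"
proof (rule ccontr)
  let ?K = "Suc k"
  assume no: "\<not> density_HJ ?K 1"
  have M: "density_HJ k d" for d using density_HJ_of_line[OF k 1] .
  obtain \<alpha> where \<alpha>: "0 < \<alpha>"
    and upper: "\<And>e. 0 < e \<Longrightarrow> \<exists>n. \<forall>I A. finite I \<longrightarrow> n \<le> card I \<longrightarrow> line_free ?K I A \<longrightarrow> dens ?K I A \<le> \<alpha> + e"
    and lower: "\<And>e n. 0 < e \<Longrightarrow> \<exists>I A. finite I \<and> n \<le> card I \<and> line_free ?K I A \<and> \<alpha> - e \<le> dens ?K I A"
    using critical_density[OF _ no] by blast
  obtain \<theta> where \<theta>: "0 < \<theta>"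
    and obst: "\<And>p \<gamma>. 0 < \<gamma> \<Longrightarrow> \<exists>J A D. finite J \<and> p \<le> card J \<and> \<alpha> - \<gamma> \<le> dens ?K J A \<and> line_free ?K J A \<and>
      (\<forall>i<k. insensitive k i J (D i)) \<and>
      \<theta> \<le> avg ?K J (\<lambda>x. of_bool (\<forall>i<k. x \<in> D i)) \<and>
      (\<forall>x\<in>words ?K J. x \<in> A \<longrightarrow> \<not> (\<forall>i<k. x \<in> D i))"
    using dense_obstruction[OF k M \<alpha> upper lower] by blast
  define \<beta> where "\<beta> = \<alpha> * \<theta> / 4"
  have \<beta>: "0 < \<beta>" using \<alpha> \<theta> by (simp add: \<beta>_def)
  obtain d where d: "\<And>I A. finite I \<Longrightarrow> d \<le> card I \<Longrightarrow> line_free ?K I A \<Longrightarrow> dens ?K I A \<le> \<alpha> + \<beta>"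
    using upper[OF \<beta>] by blast
  have "0 < \<beta> / k" using \<beta> k by simp
  then obtain n where n: "\<And>I f D. finite I \<Longrightarrow> n \<le> card I \<Longrightarrow> (\<forall>x. f x \<le> 1) \<Longrightarrow>
    subspace_avg_le ?K d I f 0 \<Longrightarrow> (\<forall>i<k. insensitive k i I (D i)) \<Longrightarrow>
    avg ?K I (\<lambda>x. of_bool (\<forall>i<k. x \<in> D i) * f x) \<le> \<beta> / k"
    using insensitive_inter_avg_le[OF k M, of "\<beta> / k" k d] by blast
  obtain J A D where J: "finite J" "n \<le> card J" and dA: "\<alpha> - \<beta> \<le> dens ?K J A" and lf: "line_free ?K J A"
    and ins: "\<forall>i<k. insensitive k i J (D i)"
    and dD: "\<theta> \<le> avg ?K J (\<lambda>x. of_bool (\<forall>i<k. x \<in> D i))"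
    and disj: "\<And>x. x \<in> words ?K J \<Longrightarrow> x \<in> A \<Longrightarrow> \<not> (\<forall>i<k. x \<in> D i)"
    using obst[OF \<beta>, of n] by (elim exE conjE) (rule that, auto)
  define f where "f x = of_bool (x \<in> A) - (\<alpha> + \<beta>)" for x :: "nat \<Rightarrow> nat"
  have f1: "\<forall>x. f x \<le> 1" using \<alpha> \<beta> by (auto simp: f_def)
  have fsub: "subspace_avg_le ?K d J f 0"
    unfolding subspace_avg_le_def
  proof (intro allI impI)
    fix \<sigma> assume \<sigma>: "comb_subspace ?K d J \<sigma>"
    have "line_free ?K {..<d} {u. plug \<sigma> u \<in> A}" using has_subspace_plug[OF _ \<sigma>] lf by blast
    then have "dens ?K {..<d} {u. plug \<sigma> u \<in> A} \<le> \<alpha> + \<beta>" by (intro d) auto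
    then show "avg ?K {..<d} (\<lambda>u. f (plug \<sigma> u)) \<le> 0" by (simp add: f_def avg_diff)
  qed
  define E where "E j i = (if i < j then D i else if i = j then - D i else UNIV)" for j i
  have E: "avg ?K J (\<lambda>x. of_bool (\<forall>i<k. x \<in> E j i) * f x) \<le> \<beta> / k" if "j < k" for j
  proof (rule n[OF J f1 fsub])
    show "\<forall>i<k. insensitive k i J (E j i)"
      using ins insensitive_Compl insensitive_UNIV by (simp add: E_def)
  qed
  have part: "of_bool (\<not> (\<forall>i<k. x \<in> D i)) = (\<Sum>j<k. of_bool (\<forall>i<k. x \<in> E j i) :: real)" for x
  proof (cases "\<forall>i<k. x \<in> D i")
    case True
    then have "\<not> (\<forall>i<k. x \<in> E j i)" if "j < k" for j using that by (auto simp: E_def)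
    then have "(\<Sum>j<k. of_bool (\<forall>i<k. x \<in> E j i) :: real) = 0" by (intro sum.neutral) auto
    then show ?thesis using True by simp
  next
    case False
    define j0 where "j0 = (LEAST i. i < k \<and> x \<notin> D i)"
    have j0: "j0 < k" "x \<notin> D j0" using LeastI_ex[of "\<lambda>i. i < k \<and> x \<notin> D i"] False by (auto simp: j0_def)
    have less: "x \<in> D i" if "i < j0" for i
      using not_less_Least[of i "\<lambda>i. i < k \<and> x \<notin> D i"] that j0 by (auto simp: j0_def)
    have "(\<forall>i<k. x \<in> E j i) \<longleftrightarrow> j = j0" if "j < k" for j
    proof
      assume *: "\<forall>i<k. x \<in> E j i"
      have "x \<notin> D j" using * that by (auto simp: E_def split: if_splits)
      then have "\<not> j < j0" using less by blast
      moreover have "\<not> j0 < j" using * j0 by (auto simp: E_def)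
      ultimately show "j = j0" by simp
    qed (use j0 less in \<open>auto simp: E_def\<close>)
    then have "(\<Sum>j<k. of_bool (\<forall>i<k. x \<in> E j i) :: real) = (\<Sum>j<k. of_bool (j = j0))"
      by (intro sum.cong) auto
    also have "\<dots> = 1" using j0 by simp
    finally show ?thesis using False by simp
  qed
  have "avg ?K J (\<lambda>x. of_bool (\<not> (\<forall>i<k. x \<in> D i)) * f x)
      = (\<Sum>j<k. avg ?K J (\<lambda>x. of_bool (\<forall>i<k. x \<in> E j i) * f x))"
    unfolding part sum_distrib_right avg_sum ..
  also have "\<dots> \<le> (\<Sum>j<k. \<beta> / k)" using E by (intro sum_mono) auto
  also have "\<dots> = \<beta>" using k by simp
  finally have le: "avg ?K J (\<lambda>x. of_bool (\<not> (\<forall>i<k. x \<in> D i)) * f x) \<le> \<beta>" .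
  have "avg ?K J (\<lambda>x. of_bool (\<not> (\<forall>i<k. x \<in> D i)) * f x)
      = avg ?K J (\<lambda>x. of_bool (x \<in> A) - (\<alpha> + \<beta>) * (1 - of_bool (\<forall>i<k. x \<in> D i)))"
    using disj by (intro avg_cong) (auto simp: f_def)
  also have "\<dots> = dens ?K J A - (\<alpha> + \<beta>) * (1 - avg ?K J (\<lambda>x. of_bool (\<forall>i<k. x \<in> D i)))"
    unfolding avg_diff avg_cmult using J by simp
  also have "\<dots> \<ge> (\<alpha> - \<beta>) - (\<alpha> + \<beta>) * (1 - \<theta>)"
    using dA dD \<alpha> \<beta> by (intro diff_mono mult_left_mono) auto
  finally have "(\<alpha> - \<beta>) - (\<alpha> + \<beta>) * (1 - \<theta>) \<le> \<beta>" using le by linarith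
  moreover have "0 \<le> \<beta> * \<theta>" using \<beta> \<theta> by simp
  moreover have "\<alpha> * \<theta> = 4 * \<beta>" by (simp add: \<beta>_def)
  ultimately have "4 * \<beta> \<le> 3 * \<beta>" by (simp add: algebra_simps)
  then show False using \<beta> by simp
qed

lemma density_Hales_Jewett_line: "0 < k \<Longrightarrow> density_HJ k 1"
proof (induction k rule: nat_induct_non_zero)
  case 1
  show ?case by (rule density_HJ_one_letter)
next
  case (Suc k)
  then show ?case by (rule density_HJ_Suc_letter)
qed

section \<open>Recurrence along finite sums\<close>

lemma finite_comb_subspaces:
  assumes "finite I"
  shows "finite {\<sigma>. comb_subspace k d I \<sigma>}"
proof (rule finite_subset)
  show "{\<sigma>. comb_subspace k d I \<sigma>} \<subseteq> PiE_dflt I (Inl 0) (\<lambda>_. Inl ` {..<k} \<union> Inr ` {..<d})"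
    by (auto simp: comb_subspace_def PiE_dflt_def split: sum.splits)
       (metis imageI lessThan_iff sum.exhaust)
  show "finite (PiE_dflt I (Inl 0) (\<lambda>_. Inl ` {..<k} \<union> Inr ` {..<d} :: (nat + nat) set))"
    using assms by (intro finite_PiE_dflt) auto
qed

text \<open>For each point \<open>x\<close> the set of words \<open>w\<close> with \<open>x \<in> B w\<close> has density at most \<open>\<delta>\<close> unless it contains a line.
Integrating this over \<open>x\<close> shows that the sets \<open>X \<sigma>\<close> of points whose words contain the line \<open>\<sigma>\<close> have total
measure at least \<open>\<mu>(A) - \<delta>\<close>. As the number of lines is determined by \<open>m\<close> and \<open>l\<close>, the bound \<open>c\<close> for one of the lines
is uniform in the group elements \<open>g i j\<close>.\<close>

lemma IP_multiple_recurrence: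
  fixes M :: "'x measure" and G :: "('g, 'm) monoid_scheme" (structure)
    and \<phi> :: "'g \<Rightarrow> 'x \<Rightarrow> 'x"
  assumes "prob_space M" and "comm_group G" and "group_action G (space M) \<phi>"
    and pres: "\<forall>g\<in>carrier G. measure_preserving_map M (\<phi> g)"
    and A: "A \<in> sets M" and pos: "measure M A > 0"
  shows "\<exists>m c. 0 < c \<and> (\<forall>g :: nat \<Rightarrow> nat \<Rightarrow> 'g. (\<forall>i. \<forall>j\<le>l. g i j \<in> carrier G) \<longrightarrow>
    (\<exists>\<alpha>\<subseteq>{..<m}. \<alpha> \<noteq> {} \<and>
       c \<le> measure M (\<Inter>j\<in>{0..l}. \<phi> (\<Otimes>i\<in>\<alpha>. g i j) -` A \<inter> space M)))"
proof -
  interpret prob_space M by fact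
  interpret comm_group G by fact
  interpret group_action G "space M" \<phi> by fact
  let ?k = "Suc l"
  define \<delta> where "\<delta> = measure M A / 2"
  have \<delta>: "0 < \<delta>" using pos by (simp add: \<delta>_def)
  obtain m where m: "\<And>I A. finite I \<Longrightarrow> m \<le> card I \<Longrightarrow> \<delta> \<le> dens ?k I A \<Longrightarrow> has_subspace ?k 1 I A"
    using density_HJD[OF density_Hales_Jewett_line \<delta>, of ?k] by blast
  define L where "L = {\<sigma>. comb_subspace ?k 1 {..<m} \<sigma>}"
  have finL: "finite L" unfolding L_def by (rule finite_comb_subspaces) simp
  define c where "c = \<delta> / (real (card L) + 1)"
  show ?thesis
  proof (rule exI[of _ m], rule exI[of _ c], intro conjI allI impI)
    show "0 < c" using \<delta> by (simp add: c_def)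
    fix g :: "nat \<Rightarrow> nat \<Rightarrow> 'g" assume "\<forall>i. \<forall>j\<le>l. g i j \<in> carrier G"
    then have g: "g i j \<in> carrier G" if "j \<le> l" for i j using that by blast
    define H where "H w = (\<Otimes>i\<in>{..<m}. g i (w i))" for w
    define B where "B w = \<phi> (H w) -` A \<inter> space M" for w
    have H: "H w \<in> carrier G" if "w \<in> words ?k {..<m}" for w
      unfolding H_def using words_less[OF that] g by (intro finprod_closed) (auto simp: less_Suc_eq_le)
    have meas: "\<phi> h -` C \<inter> space M \<in> sets M" "measure M (\<phi> h -` C \<inter> space M) = measure M C"
      if "h \<in> carrier G" "C \<in> sets M" for h C
      using bspec[OF pres that(1)] that(2)
      by (auto simp: measure_preserving_map_def measure_def intro: measurable_sets)
    have B: "B w \<in> sets M" "measure M (B w) = measure M A" if "w \<in> words ?k {..<m}" for w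
      unfolding B_def using meas[OF H[OF that] A] by auto
    have int_ind: "integrable M (indicator S :: 'x \<Rightarrow> real)" if "S \<in> sets M" for S
      using that by (simp add: integrable_indicator_iff less_top[symmetric])
    define X where "X \<sigma> = (\<Inter>u\<in>words ?k {..<1}. B (plug \<sigma> u))" for \<sigma>
    have ne: "words ?k {..<1} \<noteq> {}" by (auto simp: words_def intro: exI[of _ "\<lambda>_. 0"])
    have X: "X \<sigma> \<in> sets M" if "\<sigma> \<in> L" for \<sigma>
      unfolding X_def using ne that
      by (intro sets.finite_INT B(1) plug_words[of ?k 1]) (auto simp: L_def)
    have pointwise: "avg ?k {..<m} (\<lambda>w. indicator (B w) x) \<le> \<delta> + (\<Sum>\<sigma>\<in>L. indicator (X \<sigma>) x)" for x
    proof (cases "\<delta> \<le> avg ?k {..<m} (\<lambda>w. indicator (B w) x)")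
      case True
      then have "has_subspace ?k 1 {..<m} {w. x \<in> B w}"
        by (intro m) (auto simp: indicator_def of_bool_def)
      then obtain \<sigma> where \<sigma>: "\<sigma> \<in> L" "x \<in> X \<sigma>"
        unfolding has_subspace_def L_def X_def by auto
      have "avg ?k {..<m} (\<lambda>w. indicator (B w) x) \<le> 1"
        by (intro avg_le) (auto simp: indicator_def)
      also have "1 \<le> (\<Sum>\<sigma>\<in>L. indicator (X \<sigma>) x :: real)"
        using member_le_sum[OF \<sigma>(1), of "\<lambda>\<sigma>. indicator (X \<sigma>) x :: real"] finL \<sigma>(2) by simp
      finally show ?thesis using \<delta> by simp
    next
      case False
      moreover have "0 \<le> (\<Sum>\<sigma>\<in>L. indicator (X \<sigma>) x :: real)" by (intro sum_nonneg) auto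
      ultimately show ?thesis by simp
    qed
    have "2 * \<delta> = avg ?k {..<m} (\<lambda>w. measure M (B w))"
    proof -
      have "avg ?k {..<m} (\<lambda>w. measure M (B w)) = avg ?k {..<m} (\<lambda>_. measure M A)"
        by (intro avg_cong B(2))
      then show ?thesis by (simp add: \<delta>_def)
    qed
    also have "\<dots> = (\<integral>x. avg ?k {..<m} (\<lambda>w. indicator (B w) x) \<partial>M)"
    proof -
      have "(\<integral>x. (\<Sum>w\<in>words ?k {..<m}. indicator (B w) x) \<partial>M) = (\<Sum>w\<in>words ?k {..<m}. measure M (B w))"
        using B(1) by (subst Bochner_Integration.integral_sum) (auto intro: int_ind)
      then show ?thesis by (simp add: avg_def)
    qed
    also have "\<dots> \<le> (\<integral>x. \<delta> + (\<Sum>\<sigma>\<in>L. indicator (X \<sigma>) x) \<partial>M)"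
    proof (rule integral_mono)
      show "integrable M (\<lambda>x. avg ?k {..<m} (\<lambda>w. indicator (B w) x))"
        unfolding avg_def using B(1)
        by (intro integrable_divide_zero Bochner_Integration.integrable_sum int_ind) auto
      show "integrable M (\<lambda>x. \<delta> + (\<Sum>\<sigma>\<in>L. indicator (X \<sigma>) x))"
        using X by (intro Bochner_Integration.integrable_add Bochner_Integration.integrable_sum int_ind) auto
    qed (use pointwise in auto)
    also have "\<dots> = (\<integral>x. \<delta> \<partial>M) + (\<integral>x. (\<Sum>\<sigma>\<in>L. indicator (X \<sigma>) x) \<partial>M)"
      using X by (intro Bochner_Integration.integral_add Bochner_Integration.integrable_sum int_ind) auto
    also have "\<dots> = \<delta> + (\<Sum>\<sigma>\<in>L. measure M (X \<sigma>))"
      using X by (subst Bochner_Integration.integral_sum) (auto intro: int_ind simp: prob_space)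
    finally have sumX: "\<delta> \<le> (\<Sum>\<sigma>\<in>L. measure M (X \<sigma>))" by simp
    have "\<exists>\<sigma>\<in>L. c \<le> measure M (X \<sigma>)"
    proof (rule ccontr)
      assume "\<not> ?thesis"
      then have "(\<Sum>\<sigma>\<in>L. measure M (X \<sigma>)) \<le> (\<Sum>\<sigma>\<in>L. c)" by (intro sum_mono) auto
      also have "\<dots> < \<delta>" using \<delta> by (simp add: c_def field_simps)
      finally show False using sumX by simp
    qed
    then obtain \<sigma> where "\<sigma> \<in> L" and cX: "c \<le> measure M (X \<sigma>)" by blast
    then have \<sigma>: "comb_subspace ?k 1 {..<m} \<sigma>" by (simp add: L_def)
    define \<alpha> where "\<alpha> = {i \<in> {..<m}. \<sigma> i = Inr 0}"
    define a where "a i = (case \<sigma> i of Inl b \<Rightarrow> b | Inr j \<Rightarrow> 0)" for i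
    define h0 where "h0 = (\<Otimes>i\<in>{..<m} - \<alpha>. g i (a i))"
    let ?Y = "\<lambda>j. \<phi> (\<Otimes>i\<in>\<alpha>. g i j) -` A \<inter> space M"
    have fin\<alpha>: "finite \<alpha>" by (simp add: \<alpha>_def)
    have a: "a i \<le> l" for i
      using comb_subspaceD(1,4)[OF \<sigma>, of i] by (cases "i < m") (force simp: a_def split: sum.splits)+
    have h0: "h0 \<in> carrier G" unfolding h0_def using g a by (intro finprod_closed) auto
    have g\<alpha>: "(\<Otimes>i\<in>\<alpha>. g i j) \<in> carrier G" if "j \<le> l" for j
      using g that by (intro finprod_closed) auto
    have Heq: "H (plug \<sigma> u) = (\<Otimes>i\<in>\<alpha>. g i (u 0)) \<otimes> h0" if u: "u 0 \<le> l" for u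
    proof -
      have "H (plug \<sigma> u) = (\<Otimes>i\<in>\<alpha> \<union> ({..<m} - \<alpha>). g i (plug \<sigma> u i))"
        unfolding H_def by (intro arg_cong[of _ _ "finprod G _"]) (auto simp: \<alpha>_def)
      also have "\<dots> = (\<Otimes>i\<in>\<alpha>. g i (plug \<sigma> u i)) \<otimes> (\<Otimes>i\<in>{..<m} - \<alpha>. g i (plug \<sigma> u i))"
      proof (rule finprod_Un_disjoint)
        have "plug \<sigma> u i \<le> l" for i
          using a[of i] u comb_subspaceD(2)[OF \<sigma>, of i] by (auto simp: plug_def a_def split: sum.splits)
        then show "(\<lambda>i. g i (plug \<sigma> u i)) \<in> \<alpha> \<rightarrow> carrier G"
          "(\<lambda>i. g i (plug \<sigma> u i)) \<in> {..<m} - \<alpha> \<rightarrow> carrier G" using g by auto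
      qed (auto simp: fin\<alpha>)
      also have "(\<Otimes>i\<in>\<alpha>. g i (plug \<sigma> u i)) = (\<Otimes>i\<in>\<alpha>. g i (u 0))"
        using g u by (intro finprod_cong') (auto simp: plug_def \<alpha>_def)
      also have "(\<Otimes>i\<in>{..<m} - \<alpha>. g i (plug \<sigma> u i)) = h0"
        unfolding h0_def
      proof (intro finprod_cong')
        fix i assume "i \<in> {..<m} - \<alpha>"
        then show "g i (plug \<sigma> u i) = g i (a i)"
          using comb_subspaceD(2)[OF \<sigma>, of i] by (auto simp: \<alpha>_def plug_def a_def split: sum.splits)
      qed (use g a in auto)
      finally show ?thesis .
    qed
    have Xeq: "X \<sigma> \<subseteq> \<phi> h0 -` (\<Inter>j\<in>{0..l}. ?Y j) \<inter> space M"
    proof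
      fix x assume x: "x \<in> X \<sigma>"
      then have xs: "x \<in> space M" using ne by (auto simp: X_def B_def)
      have "\<phi> h0 x \<in> ?Y j" if j: "j \<le> l" for j
      proof -
        define u where "u = (\<lambda>i::nat. if i = 0 then j else 0)"
        have "u \<in> words ?k {..<1}" using j by (auto simp: words_def u_def)
        then have "x \<in> B (plug \<sigma> u)" using x unfolding X_def by blast
        then have "\<phi> (H (plug \<sigma> u)) x \<in> A" by (simp add: B_def)
        then show ?thesis
          using Heq[of u] j composition_rule[OF xs g\<alpha>[OF j] h0] element_image[OF h0 xs refl]
          by (simp add: u_def)
      qed
      then show "x \<in> \<phi> h0 -` (\<Inter>j\<in>{0..l}. ?Y j) \<inter> space M" using xs by auto
    qed
    have Y: "(\<Inter>j\<in>{0..l}. ?Y j) \<in> sets M"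
      using meas(1)[OF g\<alpha> A] by (intro sets.finite_INT) auto
    have "c \<le> measure M (\<phi> h0 -` (\<Inter>j\<in>{0..l}. ?Y j) \<inter> space M)"
      using cX finite_measure_mono[OF Xeq meas(1)[OF h0 Y]] by simp
    also have "\<dots> = measure M (\<Inter>j\<in>{0..l}. ?Y j)" by (rule meas(2)[OF h0 Y])
    finally have "c \<le> measure M (\<Inter>j\<in>{0..l}. ?Y j)" .
    moreover have "\<alpha> \<noteq> {}" using comb_subspaceD(5)[OF \<sigma>, of 0] by (auto simp: \<alpha>_def)
    ultimately show "\<exists>\<alpha>\<subseteq>{..<m}. \<alpha> \<noteq> {} \<and> c \<le> measure M (\<Inter>j\<in>{0..l}. \<phi> (\<Otimes>i\<in>\<alpha>. g i j) -` A \<inter> space M)"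
      by (intro exI[of _ \<alpha>]) (auto simp: \<alpha>_def)
  qed
qed

section \<open>Bounded gaps\<close>

text \<open>If the conclusion fails, there are arbitrarily long intervals whose elements \<open>N\<close> have fewer than
\<open>N / 2\<^bsup>m+2\<^esup>\<close> partners \<open>n\<close>. Choose each new \<open>N i\<close> inside such an interval in a way that all sums of \<open>N i\<close> with
earlier terms stay in the interval and are at most twice \<open>N i\<close>. A given subset of the earlier indices
then excludes at most \<open>2 * N i / 2\<^bsup>m+2\<^esup>\<close> values of \<open>n i\<close>, and all the at most \<open>2\<^sup>m\<close> subsets together
exclude at most half of \<open>{1..N i}\<close>. After \<open>m\<close> steps no subsum satisfies \<open>Q\<close>.\<close>

lemma IP_recurrent_pairs_syndetic:
  fixes Q :: "nat \<Rightarrow> nat \<Rightarrow> bool"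
  assumes Q: "\<And>n N :: nat \<Rightarrow> nat. \<exists>\<alpha>\<subseteq>{..<m}. \<alpha> \<noteq> {} \<and> Q (\<Sum>i\<in>\<alpha>. n i) (\<Sum>i\<in>\<alpha>. N i)"
  shows "\<exists>H. \<forall>L. \<exists>N. L < N \<and> N \<le> L + H \<and> real N / 2 ^ (m + 2) \<le> card {n \<in> {1..N}. Q n N}"
proof (rule ccontr)
  assume "\<not> ?thesis"
  then have thick: "\<exists>L. \<forall>N. L < N \<and> N \<le> L + H \<longrightarrow> card {n \<in> {1..N}. Q n N} < real N / 2 ^ (m + 2)" for H
    by (meson not_le)
  have "\<exists>n N. (\<forall>t<i. n t \<le> N t) \<and>
      (\<forall>\<alpha>\<subseteq>{..<i}. \<alpha> \<noteq> {} \<longrightarrow> \<not> Q (\<Sum>t\<in>\<alpha>. n t) (\<Sum>t\<in>\<alpha>. N t))" if "i \<le> m" for i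
    using that
  proof (induction i)
    case 0
    then show ?case by simp
  next
    case (Suc i)
    then obtain n N :: "nat \<Rightarrow> nat" where le: "\<And>t. t < i \<Longrightarrow> n t \<le> N t"
      and IH: "\<And>\<alpha>. \<alpha> \<subseteq> {..<i} \<Longrightarrow> \<alpha> \<noteq> {} \<Longrightarrow> \<not> Q (\<Sum>t\<in>\<alpha>. n t) (\<Sum>t\<in>\<alpha>. N t)" by auto
    define s where "s = (\<Sum>t<i. N t)"
    obtain L where L: "\<And>N'. L < N' \<Longrightarrow> N' \<le> L + (2 * s + 1) \<Longrightarrow>
        card {n \<in> {1..N'}. Q n N'} < real N' / 2 ^ (m + 2)"
      using thick[of "2 * s + 1"] by blast
    \<comment> \<open>Adding a sum of earlier terms, which is at most \<open>s\<close>, leads neither out of the interval nor beyond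
      \<open>2 * N0\<close>.\<close>
    define N0 where "N0 = L + 1 + s"
    define bad where "bad \<alpha> = {v \<in> {1..N0}. Q (v + (\<Sum>t\<in>\<alpha>. n t)) (N0 + (\<Sum>t\<in>\<alpha>. N t))}" for \<alpha>
    have card_bad: "real (card (bad \<alpha>)) \<le> 2 * real N0 / 2 ^ (m + 2)" if \<alpha>: "\<alpha> \<subseteq> {..<i}" for \<alpha>
    proof -
      define n' N' where "n' = (\<Sum>t\<in>\<alpha>. n t)" and "N' = (\<Sum>t\<in>\<alpha>. N t)"
      have Ns: "N' \<le> s" unfolding s_def N'_def using \<alpha> by (intro sum_mono2) auto
      have nN: "n' \<le> N'" unfolding n'_def N'_def using \<alpha> le by (intro sum_mono) auto
      have "card (bad \<alpha>) = card ((\<lambda>v. v + n') ` bad \<alpha>)" by (simp add: card_image)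
      also have "\<dots> \<le> card {n \<in> {1..N0 + N'}. Q n (N0 + N')}"
        using nN by (intro card_mono) (auto simp: bad_def n'_def N'_def)
      finally have "real (card (bad \<alpha>)) \<le> real (card {n \<in> {1..N0 + N'}. Q n (N0 + N')})" by simp
      also have "\<dots> \<le> real (N0 + N') / 2 ^ (m + 2)"
        using Ns by (intro less_imp_le[OF L]) (auto simp: N0_def)
      also have "\<dots> \<le> 2 * real N0 / 2 ^ (m + 2)"
        using Ns by (intro divide_right_mono) (auto simp: N0_def)
      finally show ?thesis .
    qed
    have "real (card (\<Union>\<alpha>\<in>Pow {..<i}. bad \<alpha>)) \<le> real (\<Sum>\<alpha>\<in>Pow {..<i}. card (bad \<alpha>))"
      unfolding of_nat_le_iff by (rule card_UN_le) simp
    also have "\<dots> \<le> (\<Sum>\<alpha>\<in>Pow {..<i}. 2 * real N0 / 2 ^ (m + 2))"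
      unfolding of_nat_sum using card_bad by (intro sum_mono) auto
    also have "\<dots> = 2 ^ i * (2 * real N0 / 2 ^ (m + 2))" by (simp add: card_Pow)
    also have "\<dots> \<le> 2 ^ m * (2 * real N0 / 2 ^ (m + 2))"
      using Suc.prems by (intro mult_right_mono power_increasing) auto
    also have "\<dots> = real N0 / 2" by simp
    also have "\<dots> < real (card {1..N0})" by (simp add: N0_def)
    finally have "\<not> {1..N0} \<subseteq> (\<Union>\<alpha>\<in>Pow {..<i}. bad \<alpha>)"
      using card_mono[of "\<Union>\<alpha>\<in>Pow {..<i}. bad \<alpha>" "{1..N0}"] by (auto simp: bad_def)
    then obtain v where v: "v \<in> {1..N0}" "\<And>\<alpha>. \<alpha> \<subseteq> {..<i} \<Longrightarrow> v \<notin> bad \<alpha>" by blast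
    show ?case
    proof (rule exI[of _ "n(i := v)"], rule exI[of _ "N(i := N0)"], intro conjI allI impI)
      show "(n(i := v)) t \<le> (N(i := N0)) t" if "t < Suc i" for t using that le v by auto
      fix \<alpha> assume \<alpha>: "\<alpha> \<subseteq> {..<Suc i}" "\<alpha> \<noteq> {}"
      have fin: "finite \<alpha>" using \<alpha> finite_subset by blast
      show "\<not> Q (\<Sum>t\<in>\<alpha>. (n(i := v)) t) (\<Sum>t\<in>\<alpha>. (N(i := N0)) t)"
      proof (cases "i \<in> \<alpha>")
        case True
        have sub: "\<alpha> - {i} \<subseteq> {..<i}" using \<alpha> by (auto simp: less_Suc_eq)
        have "(\<Sum>t\<in>\<alpha>. (n(i := v)) t) = v + (\<Sum>t\<in>\<alpha> - {i}. n t)"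
          "(\<Sum>t\<in>\<alpha>. (N(i := N0)) t) = N0 + (\<Sum>t\<in>\<alpha> - {i}. N t)"
          using fin True by (simp_all add: sum.remove)
        then show ?thesis using v(1) v(2)[OF sub] by (simp add: bad_def)
      next
        case False
        then have "\<alpha> \<subseteq> {..<i}" using \<alpha> by (auto simp: less_Suc_eq)
        moreover have "(\<Sum>t\<in>\<alpha>. (n(i := v)) t) = (\<Sum>t\<in>\<alpha>. n t)" "(\<Sum>t\<in>\<alpha>. (N(i := N0)) t) = (\<Sum>t\<in>\<alpha>. N t)"
          using False by (auto intro!: sum.cong)
        ultimately show ?thesis using IH \<alpha> by simp
      qed
    qed
  qed
  from this[of m] Q show False by (metis le_refl)
qed

lemma (in comm_group) finprod_pow_mult:
  assumes "finite I" "a \<in> carrier G" "b \<in> carrier G"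
  shows "(\<Otimes>i\<in>I. a [^] (n i :: nat) \<otimes> b [^] (N i :: nat)) = a [^] (\<Sum>i\<in>I. n i) \<otimes> b [^] (\<Sum>i\<in>I. N i)"
  using assms(1)
proof (induction I rule: finite_induct)
  case (insert i I)
  then have "(\<Otimes>i\<in>insert i I. a [^] n i \<otimes> b [^] N i)
      = (a [^] n i \<otimes> b [^] N i) \<otimes> (a [^] (\<Sum>i\<in>I. n i) \<otimes> b [^] (\<Sum>i\<in>I. N i))"
    using assms by (subst finprod_insert) auto
  also have "\<dots> = (a [^] n i \<otimes> a [^] (\<Sum>i\<in>I. n i)) \<otimes> (b [^] N i \<otimes> b [^] (\<Sum>i\<in>I. N i))"
    using assms by (simp add: m_ac)
  finally show ?case using insert assms by (simp add: nat_pow_mult)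
qed simp

theorem theorem2p5:
  fixes M :: "'x measure"
    and G :: "('g, 'm) monoid_scheme" (structure)
    and \<phi> :: "'g \<Rightarrow> 'x \<Rightarrow> 'x"
    and T T' :: "nat \<Rightarrow> 'g"
    and l :: nat
    and A :: "'x set"
  assumes "prob_space M"
    and "separable_measure M"
    and "free_fg_abelian_group G"
    and "group_action G (space M) \<phi>"
    and "\<And>g. g \<in> carrier G \<Longrightarrow> measure_preserving_map M (\<phi> g)"
    and "\<And>j. j \<in> {1..l} \<Longrightarrow> T j \<in> carrier G"
    and "\<And>j. j \<in> {1..l} \<Longrightarrow> T' j \<in> carrier G"
    and "inj_on T {1..l}"
    and "\<And>j. j \<in> {1..l} \<Longrightarrow> T j \<noteq> \<one>"
    and "T 0 = \<one>"
    and "T' 0 = \<one>"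
    and "A \<in> sets M"
    and "measure M A > 0"
  shows "\<exists>\<N> :: nat set. \<N> \<subseteq> {1..} \<and> infinite \<N> \<and> uniformly_bounded_gaps \<N> \<and>
           Liminf (inf sequentially (principal \<N>))
             (\<lambda>N. ereal (1 / real N * (\<Sum>n = 1..N.
                measure M (\<Inter>j\<in>{0..l}. \<phi> (T j [^] n \<otimes> T' j [^] N) -` A \<inter> space M)))) > 0"
proof -
  have G: "comm_group G" using assms(3) by (simp add: free_fg_abelian_group_def)
  interpret comm_group G by (rule G)
  have T: "T j \<in> carrier G" "T' j \<in> carrier G" if "j \<le> l" for j
  proof -
    have "T j \<in> carrier G \<and> T' j \<in> carrier G"
    proof (cases "j = 0")
      case True
      then show ?thesis by (simp add: assms(10,11))
    next
      case False
      then have "j \<in> {1..l}" using that by simp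
      then show ?thesis using assms(6,7) by blast
    qed
    then show "T j \<in> carrier G" "T' j \<in> carrier G" by auto
  qed
  have pres: "\<forall>g\<in>carrier G. measure_preserving_map M (\<phi> g)" using assms(5) by blast
  define q where "q n N = measure M (\<Inter>j\<in>{0..l}. \<phi> (T j [^] n \<otimes> T' j [^] N) -` A \<inter> space M)" for n N :: nat
  obtain m c where c: "0 < c"
    and rec: "\<forall>g :: nat \<Rightarrow> nat \<Rightarrow> 'g. (\<forall>i. \<forall>j\<le>l. g i j \<in> carrier G) \<longrightarrow>
       (\<exists>\<alpha>\<subseteq>{..<m}. \<alpha> \<noteq> {} \<and> c \<le> measure M (\<Inter>j\<in>{0..l}. \<phi> (\<Otimes>i\<in>\<alpha>. g i j) -` A \<inter> space M))"
    using IP_multiple_recurrence[OF assms(1) G assms(4) pres assms(12,13), of l] by (elim exE conjE)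
  have "\<exists>\<alpha>\<subseteq>{..<m}. \<alpha> \<noteq> {} \<and> c \<le> q (\<Sum>i\<in>\<alpha>. n i) (\<Sum>i\<in>\<alpha>. N i)" for n N :: "nat \<Rightarrow> nat"
  proof -
    obtain \<alpha> where \<alpha>: "\<alpha> \<subseteq> {..<m}" "\<alpha> \<noteq> {}"
      "c \<le> measure M (\<Inter>j\<in>{0..l}. \<phi> (\<Otimes>i\<in>\<alpha>. T j [^] n i \<otimes> T' j [^] N i) -` A \<inter> space M)"
      using spec[OF rec, of "\<lambda>i j. T j [^] n i \<otimes> T' j [^] N i"] T by auto
    have "(\<Otimes>i\<in>\<alpha>. T j [^] n i \<otimes> T' j [^] N i) = T j [^] (\<Sum>i\<in>\<alpha>. n i) \<otimes> T' j [^] (\<Sum>i\<in>\<alpha>. N i)"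
      if "j \<in> {0..l}" for j
      using T that finite_subset[OF \<alpha>(1)] by (intro finprod_pow_mult) auto
    then show ?thesis using \<alpha> by (intro exI[of _ \<alpha>]) (simp add: q_def cong: INF_cong_simp)
  qed
  then obtain H where H: "\<And>L. \<exists>N. L < N \<and> N \<le> L + H \<and> real N / 2 ^ (m + 2) \<le> card {n \<in> {1..N}. c \<le> q n N}"
    using IP_recurrent_pairs_syndetic[of m "\<lambda>n N. c \<le> q n N"] by blast
  define \<N> where "\<N> = {N. 1 \<le> N \<and> real N / 2 ^ (m + 2) \<le> card {n \<in> {1..N}. c \<le> q n N}}"
  have ex: "\<exists>N\<in>\<N>. L < N \<and> N \<le> L + H" for L
    using H[of L] unfolding \<N>_def by fastforce
  have "infinite \<N>" unfolding infinite_nat_iff_unbounded using ex by blast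
  moreover have "uniformly_bounded_gaps \<N>"
    unfolding uniformly_bounded_gaps_def
  proof (intro exI[of _ H] ballI impI)
    fix a b assume *: "a \<in> \<N>" "b \<in> \<N>" "a < b \<and> \<N> \<inter> {a<..<b} = {}"
    obtain N where "N \<in> \<N>" "a < N" "N \<le> a + H" using ex by blast
    then show "b - a \<le> H" using * by (cases "N < b") auto
  qed
  moreover have "0 < Liminf (inf sequentially (principal \<N>)) (\<lambda>N. ereal (1 / real N * (\<Sum>n = 1..N. q n N)))"
  proof -
    have "c / 2 ^ (m + 2) \<le> 1 / real N * (\<Sum>n = 1..N. q n N)" if "N \<in> \<N>" for N
    proof -
      let ?S = "{n \<in> {1..N}. c \<le> q n N}"
      have N: "1 \<le> N" "real N / 2 ^ (m + 2) \<le> card ?S" using that by (auto simp: \<N>_def)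
      have "real N / 2 ^ (m + 2) * c \<le> real (card ?S) * c" using N c by (intro mult_right_mono) auto
      also have "\<dots> = (\<Sum>n\<in>?S. c)" by simp
      also have "\<dots> \<le> (\<Sum>n\<in>?S. q n N)" by (intro sum_mono) auto
      also have "\<dots> \<le> (\<Sum>n = 1..N. q n N)" by (intro sum_mono2) (auto simp: q_def)
      finally show ?thesis using N(1) by (simp add: field_simps)
    qed
    then have "ereal (c / 2 ^ (m + 2)) \<le> Liminf (inf sequentially (principal \<N>)) (\<lambda>N. ereal (1 / real N * (\<Sum>n = 1..N. q n N)))"
      by (intro Liminf_bounded) (auto simp: eventually_inf_principal)
    moreover have "0 < ereal (c / 2 ^ (m + 2))" using c by simp
    ultimately show ?thesis by (rule less_le_trans[rotated])
  qed
  ultimately show ?thesis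
    unfolding q_def by (intro exI[of _ \<N>]) (auto simp: \<N>_def)
qed

end
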